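(* Let $V\colon X\to[0,\infty)$ be bounded and $\mathfrak{B}$-measurable. Let $\hat\mu\in M_{qi,1}^V(X_\infty(r))$, and let $\mu_0:=\hat\mu\circ\theta_0^{-1}\in M_1^V(X)$. The following affirmations are equivalent: (i) $\hat\mu$ is an extreme point of $M_{qi,1}^V(X_\infty(r))$; (ii) the measure $V\circ\theta_0\,d\hat\mu$ is ergodic with respect to $\hat r$; (iii) $\mu_0$ is an extreme point of $M_1^V(X)$; (iv) $\mu_0$ is relatively ergodic with respect to $(r,V)$.
   Context: $X$ is a compact Hausdorff space, $\mathfrak{B}$ is its Borel $\sigma$-algebra, and $r\colon X\to X$ is a $\mathfrak{B}$-measurable map that is onto and finite-to-one, i.e. $1\le\#r^{-1}(x)<\infty$ for all $x\in X$, and not invertible, i.e. $\#r^{-1}(x)$ is not identically $1$. The projective limit is $X_\infty(r)=\{\hat x=(x_0,x_1,\dots)\in\prod_{n\in\mathbb{N}_0}X : r(x_{n+1})=x_n \text{ for all } n\in\mathbb{N}_0\}$, $\mathbb{N}_0=\{0,1,2,\dots\}$, with coordinate maps $\theta_n\colon X_\infty(r)\to X$, $\theta_n(\hat x)=x_n$. The map $\hat r\colon X_\infty(r)\to X_\infty(r)$, $\hat r(x_0,x_1,x_2,\dots)=(r(x_0),x_0,x_1,\dots)$, is a bijection with inverse $\hat r^{-1}(x_0,x_1,\dots)=(x_1,x_2,\dots)$. $\mathfrak{B}_n=\theta_n^{-1}(\mathfrak{B})$ is an increasing sequence of $\sigma$-algebras, and $\mathfrak{B}_\infty$ is the $\sigma$-algebra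 generated by $\bigcup_n\mathfrak{B}_n$; $\hat r$ and $\hat r^{-1}$ are $\mathfrak{B}_\infty$-measurable. All measures are positive and finite; $M(X)$ and $M(X_\infty(r))$ denote the sets of measures on $(X,\mathfrak{B})$ and $(X_\infty(r),\mathfrak{B}_\infty)$. A measure $\hat\mu$ on $(X_\infty(r),\mathfrak{B}_\infty)$ is $V$-quasi-invariant if $\hat\mu\circ\hat r\ll\hat\mu$ and $\frac{d(\hat\mu\circ\hat r)}{d\hat\mu}=V\circ\theta_0$, where $(\hat\mu\circ\hat r)(E)=\hat\mu(\hat r(E))$. Define $T_V(\mu):=(V\,d\mu)\circ r^{-1}$, i.e. $T_V(\mu)(E)=\int_{r^{-1}(E)}V\,d\mu$. Then $$M_{qi,1}^V(X_\infty(r)):=\{\hat\mu\in M(X_\infty(r)) : \hat\mu(X_\infty(r))=1,\ \hat\mu\text{ is }V\text{-quasi-invariant}\},$$ $$M_1^V(X):=\{\mu_0\in M(X) : \mu_0(X)=1,\ T_V(\mu_0)=\mu_0\}.$$ Both sets are convex. The measure $V\circ\theta_0\,d\hat\mu$ (density $V\circ\theta_0$ with respect to $\hat\mu$) is ergodic with respect to $\hat r$ if every set $A\in\mathfrak{B}_\infty$ with $\hat r(A)=A$ satisfies $\int_A V\circ\theta_0\,d\hat\mu=0$ or $\int_{X_\infty(r)\setminus A}V\circ\theta_0\,d\hat\mu=0$ (the measure itself is not required to be $\hat r$-invariant). For $\mu_0\in M_1^V(X)$ and a bounded $\mathfrak{B}$-measurable function $g$ on $X$, $E_{\mu_0}(Vg)$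 denotes the bounded $r^{-1}(\mathfrak{B})$-measurable function on $X$ such that $\int_X V\,g\,(f\circ r)\,d\mu_0=\int_X E_{\mu_0}(Vg)\,(f\circ r)\,d\mu_0$ for all bounded $\mathfrak{B}$-measurable $f$; it is unique up to a $\mu_0$-null set of $r^{-1}(\mathfrak{B})$, and $E_{\mu_0}(V)$ is the case $g=1$. The measure $\mu_0\in M_1^V(X)$ is relatively ergodic with respect to $(r,V)$ if the only non-negative, bounded $\mathfrak{B}$-measurable functions $f$ on $X$ satisfying $$E_{\mu_0}(Vf)=E_{\mu_0}(V)\,(f\circ r)$$ almost everywhere with respect to the restriction of $\mu_0$ to $r^{-1}(\mathfrak{B})$ are the functions which are constant $\mu_0$-a.e. *)

theory Defs
  imports "HOL-Probability.Probability"
begin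

text \<open>
  The space \<open>X\<close> is the whole type \<open>'a\<close>, with its Borel \<open>\<sigma>\<close>-algebra \<open>borel\<close>;
  points of the projective limit are sequences \<open>nat \<Rightarrow> 'a\<close>.
\<close>

definition proj_limit :: "('a \<Rightarrow> 'a) \<Rightarrow> (nat \<Rightarrow> 'a) set" where
  "proj_limit r = {x. \<forall>n. r (x (Suc n)) = x n}"

definition coord :: "nat \<Rightarrow> (nat \<Rightarrow> 'a) \<Rightarrow> 'a" where
  "coord n x = x n"

definition rhat :: "('a \<Rightarrow> 'a) \<Rightarrow> (nat \<Rightarrow> 'a) \<Rightarrow> (nat \<Rightarrow> 'a)" where
  "rhat r x = (\<lambda>n. case n of 0 \<Rightarrow> r (x 0) | Suc m \<Rightarrow> x m)"

text \<open>Only the space and the \<open>\<sigma>\<close>-algebra of \<open>B_inf r\<close> matter; as a measure it is null.\<close>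

definition B_inf :: "('a::topological_space \<Rightarrow> 'a) \<Rightarrow> (nat \<Rightarrow> 'a) measure" where
  "B_inf r = sigma (proj_limit r) (\<Union>n. sets (vimage_algebra (proj_limit r) (coord n) borel))"

definition finite_measures :: "'b measure \<Rightarrow> 'b measure set" where
  "finite_measures N = {M. sets M = sets N \<and> finite_measure M}"

text \<open>
  \<open>comp_rhat r M\<close> is \<open>E \<mapsto> M (rhat r ` E)\<close>. Since \<open>measure_of\<close> returns the null measure on
  set functions that are not countably additive, lemma \<open>emeasure_comp_rhat\<close> below confirms
  the intended values.
\<close>

definition comp_rhat :: "('a \<Rightarrow> 'a) \<Rightarrow> (nat \<Rightarrow> 'a) measure \<Rightarrow> (nat \<Rightarrow> 'a) measure" where
  "comp_rhat r M = measure_of (space M) (sets M) (\<lambda>E. emeasure M (rhat r ` E))"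

definition quasi_invariant ::
    "('a \<Rightarrow> real) \<Rightarrow> ('a \<Rightarrow> 'a) \<Rightarrow> (nat \<Rightarrow> 'a) measure \<Rightarrow> bool" where
  "quasi_invariant V r M \<longleftrightarrow>
     absolutely_continuous M (comp_rhat r M) \<and>
     (AE x in M. RN_deriv M (comp_rhat r M) x = ennreal (V (coord 0 x)))"

definition M_qi1 ::
    "('a::topological_space \<Rightarrow> real) \<Rightarrow> ('a \<Rightarrow> 'a) \<Rightarrow> (nat \<Rightarrow> 'a) measure set" where
  "M_qi1 V r = {M \<in> finite_measures (B_inf r).
     emeasure M (proj_limit r) = 1 \<and> quasi_invariant V r M}"

definition T_op ::
    "('a::topological_space \<Rightarrow> real) \<Rightarrow> ('a \<Rightarrow> 'a) \<Rightarrow> 'a measure \<Rightarrow> 'a measure" where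
  "T_op V r M = distr (density M (\<lambda>x. ennreal (V x))) borel r"

definition M_fix1 ::
    "('a::topological_space \<Rightarrow> real) \<Rightarrow> ('a \<Rightarrow> 'a) \<Rightarrow> 'a measure set" where
  "M_fix1 V r = {M \<in> finite_measures borel. emeasure M UNIV = 1 \<and> T_op V r M = M}"

text \<open>
  The library's \<open>extreme_point_of\<close> needs a real vector space, which \<open>'b measure\<close> is not;
  the convex combination is therefore written setwise.
\<close>

definition extreme_measure :: "'b measure \<Rightarrow> 'b measure set \<Rightarrow> bool" where
  "extreme_measure M S \<longleftrightarrow> M \<in> S \<and>
     (\<forall>M1\<in>S. \<forall>M2\<in>S. \<forall>t::real. 0 < t \<and> t < 1 \<and>
        (\<forall>A\<in>sets M. emeasure M A = ennreal t * emeasure M1 A + ennreal (1 - t) * emeasure M2 A)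
        \<longrightarrow> M1 = M \<and> M2 = M)"

text \<open>Ergodicity of a measure that need not be invariant under the map.\<close>

definition ergodic_for :: "'b measure \<Rightarrow> ('b \<Rightarrow> 'b) \<Rightarrow> bool" where
  "ergodic_for M T \<longleftrightarrow>
     (\<forall>A\<in>sets M. T ` A = A \<longrightarrow> emeasure M A = 0 \<or> emeasure M (space M - A) = 0)"

text \<open>
  The conditional expectation onto \<open>r\<^sup>-\<^sup>1\<close> of the Borel \<open>\<sigma>\<close>-algebra is the library's
  \<open>real_cond_exp\<close>; the choice of version is immaterial because the equation is only
  required almost everywhere for the restricted measure.
\<close>

definition pullback_alg :: "('a::topological_space \<Rightarrow> 'a) \<Rightarrow> 'a measure" where
  "pullback_alg r = vimage_algebra UNIV r borel"

definition relatively_ergodic ::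
    "('a::topological_space \<Rightarrow> 'a) \<Rightarrow> ('a \<Rightarrow> real) \<Rightarrow> 'a measure \<Rightarrow> bool" where
  "relatively_ergodic r V M \<longleftrightarrow>
     (\<forall>f \<in> borel_measurable borel.
        (\<forall>x. 0 \<le> f x) \<and> bounded (range f) \<and>
        (AE x in restr_to_subalg M (pullback_alg r).
           real_cond_exp M (pullback_alg r) (\<lambda>y. V y * f y) x
             = real_cond_exp M (pullback_alg r) V x * f (r x))
        \<longrightarrow> (\<exists>c::real. AE x in M. f x = c))"

lemma space_B_inf [simp]: "space (B_inf r) = proj_limit r"
  and sets_B_inf: "sets (B_inf r) =
    sigma_sets (proj_limit r) (\<Union>n. sets (vimage_algebra (proj_limit r) (coord n) borel))"
proof -
  have *: "(\<Union>n. sets (vimage_algebra (proj_limit r) (coord n) borel)) \<subseteq> Pow (proj_limit r)"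
    using sets.sets_into_space by (fastforce simp: space_vimage_algebra)
  show "space (B_inf r) = proj_limit r"
    unfolding B_inf_def using * by (rule space_measure_of)
  show "sets (B_inf r) =
      sigma_sets (proj_limit r) (\<Union>n. sets (vimage_algebra (proj_limit r) (coord n) borel))"
    unfolding B_inf_def using * by (rule sets_measure_of)
qed

lemma coord_measurable [measurable]: "coord n \<in> B_inf r \<rightarrow>\<^sub>M borel"
proof (rule measurableI)
  fix A :: "'a set" assume "A \<in> sets borel"
  then have "coord n -` A \<inter> proj_limit r \<in> sets (vimage_algebra (proj_limit r) (coord n) borel)"
    by (rule in_vimage_algebra)
  then show "coord n -` A \<inter> space (B_inf r) \<in> sets (B_inf r)"
    unfolding sets_B_inf space_B_inf by blast
qed auto

lemma measurable_B_infI: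
  assumes "f \<in> space M \<rightarrow> proj_limit r" and "\<And>n. (\<lambda>x. coord n (f x)) \<in> M \<rightarrow>\<^sub>M borel"
  shows "f \<in> M \<rightarrow>\<^sub>M B_inf r"
  unfolding B_inf_def
proof (rule measurable_measure_of)
  show "(\<Union>n. sets (vimage_algebra (proj_limit r) (coord n) borel)) \<subseteq> Pow (proj_limit r)"
    using sets.sets_into_space by (fastforce simp: space_vimage_algebra)
  show "f \<in> space M \<rightarrow> proj_limit r" by fact
  fix Y assume "Y \<in> (\<Union>n. sets (vimage_algebra (proj_limit r) (coord n) borel))"
  then obtain n A where A: "A \<in> sets borel" "Y = coord n -` A \<inter> proj_limit r"
    by (auto simp: sets_vimage_algebra2)
  have "f -` Y \<inter> space M = (\<lambda>x. coord n (f x)) -` A \<inter> space M"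
    using assms(1) A by auto
  also have "\<dots> \<in> sets M" using assms(2) A(1) by (rule measurable_sets)
  finally show "f -` Y \<inter> space M \<in> sets M" .
qed

lemma rhat_image_eq:
  assumes "E \<subseteq> proj_limit r"
  shows "rhat r ` E = (\<lambda>x n. x (Suc n)) -` E \<inter> proj_limit r"
proof (intro equalityI subsetI)
  fix y assume "y \<in> rhat r ` E"
  then obtain x where x: "x \<in> E" "y = rhat r x" by blast
  then have "x \<in> proj_limit r" using assms by blast
  then show "y \<in> (\<lambda>x n. x (Suc n)) -` E \<inter> proj_limit r"
    using x by (auto simp: rhat_def proj_limit_def split: nat.splits)
next
  fix y assume y: "y \<in> (\<lambda>x n. x (Suc n)) -` E \<inter> proj_limit r"
  then have "y = rhat r (\<lambda>n. y (Suc n))"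
    by (auto simp: rhat_def proj_limit_def fun_eq_iff split: nat.splits)
  then show "y \<in> rhat r ` E" using y by blast
qed

lemma left_shift_measurable: "(\<lambda>x n. x (Suc n)) \<in> B_inf r \<rightarrow>\<^sub>M B_inf r"
proof (rule measurable_B_infI)
  show "(\<lambda>x n. x (Suc n)) \<in> space (B_inf r) \<rightarrow> proj_limit r"
    by (auto simp: proj_limit_def)
  fix n
  have "(\<lambda>x::nat \<Rightarrow> 'a. coord n (\<lambda>n. x (Suc n))) = coord (Suc n)"
    by (simp add: coord_def fun_eq_iff)
  then show "(\<lambda>x. coord n (\<lambda>n. x (Suc n))) \<in> B_inf r \<rightarrow>\<^sub>M borel"
    using coord_measurable[of "Suc n" r] by (simp only:)
qed

lemma emeasure_comp_rhat:
  assumes M: "sets M = sets (B_inf r)" and E: "E \<in> sets M"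
  shows "emeasure (comp_rhat r M) E = emeasure M (rhat r ` E)"
proof -
  define D where "D = distr M M (\<lambda>x n. x (Suc n))"
  have sp: "space M = proj_limit r" using sets_eq_imp_space_eq[OF M] by simp
  have sh: "(\<lambda>x n. x (Suc n)) \<in> M \<rightarrow>\<^sub>M M"
    using left_shift_measurable[of r] measurable_cong_sets[OF M M] by blast
  have eq: "emeasure D A = emeasure M (rhat r ` A)" if "A \<in> sets M" for A
    using that sets.sets_into_space[OF that] unfolding D_def
    by (simp add: emeasure_distr[OF sh] rhat_image_eq sp)
  have "measure_of (space M) (sets M) (\<lambda>E. emeasure M (rhat r ` E))
      = measure_of (space M) (sets M) (emeasure D)"
    by (rule measure_of_eq) (auto simp: sets.space_closed sets.sigma_sets_eq eq)
  also have "\<dots> = D" using measure_of_of_measure[of D] by (simp add: D_def)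
  finally show ?thesis using eq[OF E] by (simp add: comp_rhat_def)
qed

end

theory Submission
  imports Defs
begin

text \<open>
  Write \<open>W = V \<circ> \<theta>\<^sub>0\<close>. Quasi-invariance of a measure \<open>M\<close> on the projective limit says that the left
  shift, the inverse of \<open>rhat r\<close>, carries \<open>M\<close> to \<open>W dM\<close>; equivalently \<open>\<integral>h dM = \<integral>W (h \<circ> rhat r) dM\<close>
  for all \<open>h\<close> (\<open>M_qi1_iff\<close>, \<open>nn_integral_qi\<close>). Three consequences carry the proof.

  First, \<open>M\<close> is determined by its projection \<open>N\<close> to the coordinate \<open>0\<close>: iterating the integral
  identity shows that the \<open>n\<close>-th marginal of \<open>M\<close> has density
  \<open>V (V \<circ> r) \<dots> (V \<circ> r\<^sup>n\<^sup>-\<^sup>1)\<close> with respect to \<open>N\<close> (\<open>marginal_qi\<close>, \<open>qi_eqI\<close>). Conversely a fixed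
  point of the transfer operator dominated by a multiple of \<open>N\<close> is again such a projection
  (\<open>lift_dominated\<close>): the same formula prescribes consistent marginals, and they define a
  countably additive set function on cylinders because it is dominated by a multiple of \<open>M\<close>.
  The measures in a convex decomposition of \<open>N\<close> are dominated in this way, so projecting and
  lifting match the decompositions of \<open>M\<close> with those of \<open>N\<close>, and extremality of one is
  extremality of the other (\<open>extreme_qi_iff_extreme_fix\<close>).

  Secondly, in any such decomposition a component is \<open>F dM\<close> with \<open>F\<close> bounded, and it is
  quasi-invariant exactly if \<open>F \<circ> rhat r = F\<close> almost everywhere for \<open>W dM\<close>
  (\<open>qi_density_iff\<close>). An invariant set thus splits \<open>M\<close>; in the other direction the level set
  \<open>F \<le> 1\<close> is made strictly invariant by following \<open>F\<close> along the left shift, ergodicity makes it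
  trivial, and \<open>\<integral>F dM = 1\<close> then forces \<open>F = 1\<close> (\<open>extreme_iff_ergodic\<close>).

  Thirdly, the fixed point equation for \<open>f dN\<close> reads \<open>\<integral>V f (h \<circ> r) dN = \<integral>f h dN\<close> for all \<open>h\<close>, and
  \<open>E(V f) = E(V) (f \<circ> r)\<close> reads \<open>\<integral>V f (h \<circ> r) dN = \<integral>V (f \<circ> r) (h \<circ> r) dN\<close> for all \<open>h\<close>. The right-hand
  sides agree because \<open>N\<close> is fixed, so both equations have the same bounded solutions
  (\<open>relative_equation_iff\<close>). Up to normalisation, the non-negative ones are therefore the densities
  of the components in convex decompositions of \<open>N\<close> (\<open>extreme_iff_relatively_ergodic\<close>).
\<close>

section \<open>Convex combinations and densities\<close>

text \<open>
  A decomposition may be read with its two components exchanged, so it suffices to identify one.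
\<close>

lemma extreme_measureI:
  assumes "M \<in> S"
    and "\<And>N N' t. \<lbrakk>N \<in> S; N' \<in> S; 0 < t; t < 1;
          \<And>A. A \<in> sets M \<Longrightarrow> emeasure M A = ennreal t * emeasure N A + ennreal (1 - t) * emeasure N' A\<rbrakk>
        \<Longrightarrow> N = M"
  shows "extreme_measure M S"
  unfolding extreme_measure_def
proof (intro conjI ballI allI impI)
  fix N N' and t :: real
  assume *: "N \<in> S" "N' \<in> S" "0 < t \<and> t < 1 \<and>
    (\<forall>A\<in>sets M. emeasure M A = ennreal t * emeasure N A + ennreal (1 - t) * emeasure N' A)"
  show "N = M" using * by (intro assms(2)[of N N' t]) auto
  show "N' = M" using * by (intro assms(2)[of N' N "1 - t"]) (auto simp: add.commute)
qed (fact assms)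

lemma extreme_measureD:
  assumes "extreme_measure M S" "N \<in> S" "N' \<in> S" "0 < t" "t < 1"
    and "\<And>A. A \<in> sets M \<Longrightarrow> emeasure M A = ennreal t * emeasure N A + ennreal (1 - t) * emeasure N' A"
  shows "N = M" "N' = M"
  using assms unfolding extreme_measure_def by metis+

lemma dominated_summand:
  fixes t :: real
  assumes "0 < t"
    and "emeasure M A = ennreal t * emeasure N A + ennreal (1 - t) * emeasure N' A"
  shows "emeasure N A \<le> ennreal (1 / t) * emeasure M A"
proof -
  have "emeasure N A = ennreal (1 / t) * (ennreal t * emeasure N A)"
    using assms(1) by (simp add: mult.assoc[symmetric] ennreal_mult[symmetric])
  also have "\<dots> \<le> ennreal (1 / t) * emeasure M A"
    by (rule mult_left_mono) (simp_all add: assms(2))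
  finally show ?thesis .
qed

text \<open>
  Domination confines the set where a Radon--Nikodym density exceeds \<open>C\<close> to a null set, so the
  density may be truncated at \<open>C\<close>.
\<close>

lemma dominated_density:
  fixes C :: real
  assumes M: "finite_measure M" and sets_eq: "sets N = sets M" and C: "0 \<le> C"
    and le: "\<And>A. A \<in> sets M \<Longrightarrow> emeasure N A \<le> ennreal C * emeasure M A"
  obtains f where "f \<in> borel_measurable M" "\<And>x. 0 \<le> f x" "\<And>x. f x \<le> C"
    "N = density M (\<lambda>x. ennreal (f x))"
proof -
  interpret finite_measure M by fact
  have ac: "absolutely_continuous M N"
    using le by (fastforce simp: absolutely_continuous_def null_sets_def sets_eq)
  define h where "h = RN_deriv M N"
  have h[measurable]: "h \<in> borel_measurable M" by (simp add: h_def)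
  have Nh: "density M h = N" unfolding h_def by (rule density_RN_deriv[OF ac sets_eq])
  define D where "D = {x \<in> space M. ennreal C < h x}"
  have D[measurable]: "D \<in> sets M" unfolding D_def by measurable
  have "AE x in M. h x \<le> ennreal C"
  proof -
    \<comment> \<open>The excess of \<open>h\<close> over \<open>C\<close> has integral \<open>N(D) - C M(D)\<close>, which truncated subtraction makes zero.\<close>
    have "(\<integral>\<^sup>+x. (h x - ennreal C) * indicator D x \<partial>M)
        = (\<integral>\<^sup>+x. h x * indicator D x - ennreal C * indicator D x \<partial>M)"
      by (intro nn_integral_cong) (auto simp: indicator_def)
    also have "\<dots> = (\<integral>\<^sup>+x. h x * indicator D x \<partial>M) - (\<integral>\<^sup>+x. ennreal C * indicator D x \<partial>M)"
    proof (rule nn_integral_diff)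
      have "(\<integral>\<^sup>+x. ennreal C * indicator D x \<partial>M) = ennreal C * emeasure M D"
        by (rule nn_integral_cmult_indicator[OF D])
      then show "(\<integral>\<^sup>+x. ennreal C * indicator D x \<partial>M) \<noteq> \<infinity>"
        by (simp add: ennreal_mult_eq_top_iff)
    qed (auto simp: D_def indicator_def)
    also have "\<dots> = emeasure N D - ennreal C * emeasure M D"
      by (simp add: Nh[symmetric] emeasure_density nn_integral_cmult_indicator)
    also have "\<dots> = 0"
    proof -
      have "ennreal C * emeasure M D < top"
        by (simp add: ennreal_mult_less_top emeasure_eq_measure)
      then show ?thesis using le[OF D] by (simp add: diff_eq_0_iff_ennreal le_less_trans)
    qed
    finally have "AE x in M. (h x - ennreal C) * indicator D x = 0"
      by (subst (asm) nn_integral_0_iff_AE) measurable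
    then show ?thesis
      using AE_space by eventually_elim (auto simp: D_def indicator_def diff_eq_0_iff_ennreal split: if_splits)
  qed
  define f where "f x = min C (enn2real (h x))" for x
  have f[measurable]: "f \<in> borel_measurable M" unfolding f_def[abs_def] by measurable
  have "density M (\<lambda>x. ennreal (f x)) = density M h"
  proof (rule density_cong)
    show "AE x in M. ennreal (f x) = h x"
      using \<open>AE x in M. h x \<le> ennreal C\<close>
    proof eventually_elim
      case (elim x)
      then have "h x < top" by (rule le_less_trans) simp
      then have "enn2real (h x) \<le> C" using elim C by (simp add: enn2real_leI)
      then show ?case using \<open>h x < top\<close> by (simp add: f_def min_def)
    qed
  qed measurable
  then show ?thesis
    using C Nh by (intro that[OF f]) (simp_all add: f_def)
qed

lemma prob_density_const_1:
  fixes f :: "'b \<Rightarrow> real"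
  assumes "prob_space M" "f \<in> borel_measurable M" "density M (\<lambda>x. ennreal (f x)) = M" "\<And>x. 0 \<le> f x"
  shows "AE x in M. f x = 1"
proof -
  interpret prob_space M by fact
  have "density M (\<lambda>x. ennreal (f x)) = density M (\<lambda>x. 1)"
    using assms(3) by (simp add: density_1)
  then have "AE x in M. ennreal (f x) = 1"
    by (subst (asm) density_unique_iff) (use assms(2) in auto)
  then show ?thesis by eventually_elim simp
qed

text \<open>
  A bounded function \<open>f\<close> with \<open>0 \<le> f < K\<close> and mean \<open>p\<close> splits a probability measure \<open>M\<close> as
  \<open>p/K\<close> times the measure with density \<open>f/p\<close> plus \<open>1 - p/K\<close> times the one with density
  \<open>(K - f)/(K - p)\<close>. Both densities are affine in \<open>f\<close>, so both measures lie in \<open>S\<close>; if \<open>M\<close> is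
  extreme, the first of them is \<open>M\<close> and \<open>f\<close> is almost everywhere equal to \<open>p\<close>.
\<close>

lemma extreme_measure_bounded_const:
  fixes f :: "'b \<Rightarrow> real"
  assumes ext: "extreme_measure M S" and M: "prob_space M"
    and f[measurable]: "f \<in> borel_measurable M" and f_ge: "\<And>x. 0 \<le> f x" and f_le: "\<And>x. f x \<le> C"
    and closed: "\<And>a b. \<lbrakk>\<And>x. 0 \<le> a + b * f x; (\<integral>\<^sup>+x. ennreal (a + b * f x) \<partial>M) = 1\<rbrakk>
                  \<Longrightarrow> density M (\<lambda>x. ennreal (a + b * f x)) \<in> S"
  shows "\<exists>c. AE x in M. f x = c"
proof -
  interpret prob_space M by fact
  have int[simp]: "integrable M f"
    by (rule integrable_const_bound[of _ C]) (auto simp: f_ge f_le)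
  define p where "p = (\<integral>x. f x \<partial>M)"
  show ?thesis
  proof (cases "p = 0")
    case True
    then have "AE x in M. f x = 0"
      unfolding p_def by (subst (asm) integral_nonneg_eq_0_iff_AE) (auto simp: f_ge)
    then show ?thesis by blast
  next
    case False
    then have p: "0 < p"
      using Bochner_Integration.integral_nonneg[of M f] f_ge by (simp add: p_def order_less_le)
    \<comment> \<open>Any bound strictly above \<open>f\<close> keeps the weight of the second component positive.\<close>
    define K where "K = C + 1"
    have "p \<le> C"
      unfolding p_def using Bochner_Integration.integral_mono[OF int, of "\<lambda>_. C"] f_le by (simp add: prob_space)
    then have pK: "p < K" by (simp add: K_def)
    have K: "0 < K" using p pK by simp
    have fK: "f x < K" for x using f_le[of x] by (simp add: K_def)
    define g where "g x = 0 + (1 / p) * f x" for x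
    define g' where "g' x = K / (K - p) + (- 1 / (K - p)) * f x" for x
    have g'_eq: "g' x = (K - f x) / (K - p)" for x by (simp add: g'_def diff_divide_distrib)
    have g0: "0 \<le> g x" and g'0: "0 \<le> g' x" for x
      using p pK fK[of x] f_ge[of x] by (auto simp: g_def g'_eq)
    have "(\<integral>\<^sup>+x. ennreal (g x) \<partial>M) = ennreal (\<integral>x. g x \<partial>M)"
      by (rule nn_integral_eq_integral) (auto simp: g_def f_ge p less_imp_le)
    also have "(\<integral>x. g x \<partial>M) = 1" using p by (simp add: g_def p_def)
    finally have g1: "density M (\<lambda>x. ennreal (g x)) \<in> S"
      unfolding g_def using g0 by (intro closed) (simp_all add: g_def)
    have "(\<integral>\<^sup>+x. ennreal (g' x) \<partial>M) = ennreal (\<integral>x. g' x \<partial>M)"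
      by (rule nn_integral_eq_integral) (use g'0 in \<open>auto simp: g'_def\<close>)
    also have "(\<integral>x. g' x \<partial>M) = (K - p) / (K - p)"
      by (simp add: g'_eq p_def prob_space)
    finally have g'1: "density M (\<lambda>x. ennreal (g' x)) \<in> S"
      unfolding g'_def using g'0 pK by (intro closed) (simp_all add: g'_def)
    have "density M (\<lambda>x. ennreal (g x)) = M"
    proof (rule extreme_measureD(1)[OF ext g1 g'1])
      show "0 < p / K" "p / K < 1" using p pK by auto
      fix A assume A[measurable]: "A \<in> sets M"
      have 1: "ennreal (p / K) * ennreal (g x) + ennreal (1 - p / K) * ennreal (g' x) = 1" for x
      proof -
        have "ennreal (p / K) * ennreal (g x) + ennreal (1 - p / K) * ennreal (g' x)
           = ennreal (p / K * g x + (1 - p / K) * g' x)"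
          using p pK K g0 g'0 by (simp add: ennreal_mult[symmetric] ennreal_plus[symmetric] del: ennreal_plus)
        also have "p / K * g x + (1 - p / K) * g' x = 1"
        proof -
          have "p / K * g x = f x / K" using p by (simp add: g_def)
          moreover have "(1 - p / K) * g' x = (K - f x) / K"
            using pK K by (simp add: g'_eq field_simps)
          ultimately show ?thesis using K by (simp add: field_simps)
        qed
        finally show ?thesis by simp
      qed
      have "emeasure M A = (\<integral>\<^sup>+x. indicator A x \<partial>M)" by simp
      also have "\<dots> = (\<integral>\<^sup>+x. (ennreal (p / K) * ennreal (g x) + ennreal (1 - p / K) * ennreal (g' x))
                * indicator A x \<partial>M)"
        unfolding 1 by simp
      also have "\<dots> = (\<integral>\<^sup>+x. ennreal (p / K) * (ennreal (g x) * indicator A x)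
                 + ennreal (1 - p / K) * (ennreal (g' x) * indicator A x) \<partial>M)"
        by (simp only: distrib_right mult.assoc)
      also have "\<dots> = ennreal (p / K) * emeasure (density M (\<lambda>x. ennreal (g x))) A
          + ennreal (1 - p / K) * emeasure (density M (\<lambda>x. ennreal (g' x))) A"
        by (simp add: nn_integral_add nn_integral_cmult emeasure_density g_def g'_def)
      finally show "emeasure M A = \<dots>" .
    qed
    then have "AE x in M. g x = 1"
      by (intro prob_density_const_1) (auto simp: g0 prob_space_axioms, simp add: g_def)
    then have "AE x in M. f x = p" by eventually_elim (use p in \<open>simp add: g_def\<close>)
    then show ?thesis by blast
  qed
qed

text \<open>
  The convex combination is realised by tossing a coin with bias \<open>t\<close> to choose the measure, which
  gives its integrals at once, without a separate proof of countable additivity.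
\<close>

lemma mixture:
  fixes t :: real
  assumes L: "prob_space L" and L': "prob_space L'" and sets_eq: "sets L' = sets L" and t: "0 \<le> t" "t \<le> 1"
  obtains K where "sets K = sets L"
    "\<And>h. h \<in> borel_measurable L \<Longrightarrow>
      (\<integral>\<^sup>+x. h x \<partial>K) = ennreal t * (\<integral>\<^sup>+x. h x \<partial>L) + ennreal (1 - t) * (\<integral>\<^sup>+x. h x \<partial>L')"
proof
  define \<kappa> where "\<kappa> b = (if b then L else L')" for b
  have meas: "\<kappa> \<in> measure_pmf (bernoulli_pmf t) \<rightarrow>\<^sub>M subprob_algebra L"
    using L L' by (auto simp: \<kappa>_def space_subprob_algebra sets_eq prob_space_imp_subprob_space)
  show "sets (measure_pmf (bernoulli_pmf t) \<bind> \<kappa>) = sets L"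
    by (rule sets_bind[where N = L]) (auto simp: \<kappa>_def sets_eq)
  show "(\<integral>\<^sup>+x. h x \<partial>(measure_pmf (bernoulli_pmf t) \<bind> \<kappa>))
      = ennreal t * (\<integral>\<^sup>+x. h x \<partial>L) + ennreal (1 - t) * (\<integral>\<^sup>+x. h x \<partial>L')"
    if "h \<in> borel_measurable L" for h
    by (subst nn_integral_bind[OF that meas]) (simp add: \<kappa>_def t mult.commute)
qed

section \<open>The projective limit\<close>

definition lshift :: "(nat \<Rightarrow> 'a) \<Rightarrow> nat \<Rightarrow> 'a" where
  "lshift x = (\<lambda>n. x (Suc n))"

lemma coord_lshift: "coord n (lshift x) = coord (Suc n) x"
  by (simp add: coord_def lshift_def)

lemma lshift_rhat: "lshift (rhat r x) = x"
  by (simp add: lshift_def rhat_def)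

lemma lshift_in: "x \<in> proj_limit r \<Longrightarrow> lshift x \<in> proj_limit r"
  by (simp add: proj_limit_def lshift_def)

lemma rhat_in: "x \<in> proj_limit r \<Longrightarrow> rhat r x \<in> proj_limit r"
  by (auto simp: proj_limit_def rhat_def split: nat.splits)

lemma rhat_lshift: "x \<in> proj_limit r \<Longrightarrow> rhat r (lshift x) = x"
  by (auto simp: proj_limit_def rhat_def lshift_def fun_eq_iff split: nat.splits)

lemma coord_0_rhat: "coord 0 (rhat r x) = r (coord 0 x)"
  and coord_Suc_rhat: "coord (Suc n) (rhat r x) = coord n x"
  by (simp_all add: coord_def rhat_def)

text \<open>
  The equation that lets a statement about \<open>x\<^sub>0\<close> be read as one about a later coordinate.
\<close>

lemma coord_shift_index:
  assumes "x \<in> proj_limit r"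
  shows "coord n x = (r ^^ k) (coord (n + k) x)"
proof (induction k)
  case (Suc k)
  have "coord (n + k) x = r (coord (n + Suc k) x)"
    using assms by (simp add: proj_limit_def coord_def)
  then show ?case using Suc by (simp add: funpow_swap1)
qed simp

text \<open>
  The later coordinates of a preimage of \<open>y\<close> under \<open>coord 0\<close> are chosen one after the other with a
  right inverse of \<open>r\<close>; the other coordinates follow by applying \<open>rhat r\<close>.
\<close>

lemma coord_onto:
  assumes "surj r"
  shows "\<exists>x\<in>proj_limit r. coord n x = y"
proof (induction n)
  case 0
  define x where "x = rec_nat y (\<lambda>_ z. inv r z)"
  have "x \<in> proj_limit r"
    using assms by (simp add: proj_limit_def x_def surj_f_inv_f)
  moreover have "coord 0 x = y" by (simp add: coord_def x_def)
  ultimately show ?case by blast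
next
  case (Suc n)
  then obtain x where "x \<in> proj_limit r" "coord n x = y" by blast
  then have "rhat r x \<in> proj_limit r" "coord (Suc n) (rhat r x) = y"
    by (simp_all add: rhat_in coord_Suc_rhat)
  then show ?case by blast
qed

lemma lshift_measurable [measurable]: "lshift \<in> B_inf r \<rightarrow>\<^sub>M B_inf r"
  using left_shift_measurable by (simp add: lshift_def[abs_def])

lemma rhat_measurable:
  assumes [measurable]: "r \<in> borel \<rightarrow>\<^sub>M borel"
  shows "rhat r \<in> B_inf r \<rightarrow>\<^sub>M B_inf r"
proof (rule measurable_B_infI)
  show "rhat r \<in> space (B_inf r) \<rightarrow> proj_limit r" by (simp add: rhat_in)
  show "(\<lambda>x. coord n (rhat r x)) \<in> B_inf r \<rightarrow>\<^sub>M borel" for n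
    by (cases n) (simp_all add: coord_0_rhat coord_Suc_rhat)
qed

text \<open>
  The sets depending on a single coordinate. Since \<open>x\<^sub>n\<close> determines \<open>x\<^sub>k\<close> for \<open>k \<le> n\<close>, finitely
  many of them always depend on one common coordinate, so they form an algebra.
\<close>

definition cylinders :: "('a::topological_space \<Rightarrow> 'a) \<Rightarrow> (nat \<Rightarrow> 'a) set set" where
  "cylinders r = {coord n -` A \<inter> proj_limit r | n A. A \<in> sets borel}"

lemma sets_B_inf_cylinders: "sets (B_inf r) = sigma_sets (proj_limit r) (cylinders r)"
proof -
  have "(\<Union>n. sets (vimage_algebra (proj_limit r) (coord n) borel)) = cylinders r"
    by (auto simp: cylinders_def sets_vimage_algebra2)
  then show ?thesis by (simp add: sets_B_inf)
qed

lemma cylinder_raise: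
  "coord n -` A \<inter> proj_limit r = coord (n + k) -` ((r ^^ k) -` A) \<inter> proj_limit r"
  using coord_shift_index[of _ r n k] by auto

lemma funpow_vimage_borel:
  assumes "r \<in> borel \<rightarrow>\<^sub>M borel" "A \<in> sets (borel :: 'a::topological_space measure)"
  shows "((r :: 'a \<Rightarrow> 'a) ^^ k) -` A \<in> sets borel"
  using measurable_sets[OF measurable_compose_n[OF assms(1), of k] assms(2)] by simp

lemma cylinders_common:
  assumes r: "r \<in> borel \<rightarrow>\<^sub>M borel" and "E \<in> cylinders r" "F \<in> cylinders r"
  obtains n A B where "A \<in> sets borel" "B \<in> sets borel"
    "E = coord n -` A \<inter> proj_limit r" "F = coord n -` B \<inter> proj_limit r"
proof -
  obtain n A m B where *: "A \<in> sets borel" "B \<in> sets borel"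
    "E = coord n -` A \<inter> proj_limit r" "F = coord m -` B \<inter> proj_limit r"
    using assms by (auto simp: cylinders_def)
  show ?thesis
  proof (rule that)
    show "(r ^^ m) -` A \<in> sets borel" "(r ^^ n) -` B \<in> sets borel"
      using * by (simp_all add: funpow_vimage_borel r)
    show "E = coord (n + m) -` ((r ^^ m) -` A) \<inter> proj_limit r"
      using * by (simp add: cylinder_raise[of n])
    show "F = coord (n + m) -` ((r ^^ n) -` B) \<inter> proj_limit r"
      using * by (simp add: cylinder_raise[of m _ r n] add.commute)
  qed
qed

lemma cylinders_ring:
  assumes r: "r \<in> borel \<rightarrow>\<^sub>M borel"
  shows "ring_of_sets (proj_limit r) (cylinders r)"
proof (rule ring_of_setsI)
  show "cylinders r \<subseteq> Pow (proj_limit r)" by (auto simp: cylinders_def)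
  show "{} \<in> cylinders r"
    unfolding cylinders_def by (auto intro!: exI[of _ "{}"])
  fix E F assume "E \<in> cylinders r" "F \<in> cylinders r"
  then obtain n A B where *: "A \<in> sets borel" "B \<in> sets borel"
    "E = coord n -` A \<inter> proj_limit r" "F = coord n -` B \<inter> proj_limit r"
    by (rule cylinders_common[OF r])
  have "E \<union> F = coord n -` (A \<union> B) \<inter> proj_limit r" "E - F = coord n -` (A - B) \<inter> proj_limit r"
    using * by auto
  then show "E \<union> F \<in> cylinders r" "E - F \<in> cylinders r"
    unfolding cylinders_def using * by blast+
qed

lemma proj_limit_cylinder: "proj_limit r \<in> cylinders r"
  unfolding cylinders_def by (rule CollectI, rule exI[of _ 0], rule exI[of _ UNIV]) simp

text \<open>
  The marginals are the values on cylinders, a generator closed under intersections.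
\<close>

lemma measure_eqI_marginals:
  assumes r: "r \<in> borel \<rightarrow>\<^sub>M borel"
    and M[measurable_cong]: "sets M = sets (B_inf r)" and N[measurable_cong]: "sets N = sets (B_inf r)"
    and fin: "finite_measure M"
    and eq: "\<And>n. distr M borel (coord n) = distr N borel (coord n)"
  shows "M = N"
proof (rule measure_eqI_generator_eq[where E = "cylinders r" and A = "\<lambda>_. proj_limit r"])
  interpret finite_measure M by fact
  interpret R: ring_of_sets "proj_limit r" "cylinders r" by (rule cylinders_ring[OF r])
  show "Int_stable (cylinders r)" by (auto simp: Int_stable_def)
  show "cylinders r \<subseteq> Pow (proj_limit r)" by (rule R.space_closed)
  show "sets M = sigma_sets (proj_limit r) (cylinders r)"
    "sets N = sigma_sets (proj_limit r) (cylinders r)"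
    by (simp_all add: M N sets_B_inf_cylinders)
  show "emeasure M (proj_limit r) \<noteq> \<infinity>" by simp
  show "range (\<lambda>_. proj_limit r) \<subseteq> cylinders r" by (simp add: proj_limit_cylinder)
  fix E assume "E \<in> cylinders r"
  then obtain n A where A: "A \<in> sets borel" "E = coord n -` A \<inter> proj_limit r"
    unfolding cylinders_def by blast
  have sp: "space M = proj_limit r" "space N = proj_limit r"
    using sets_eq_imp_space_eq[OF M] sets_eq_imp_space_eq[OF N] by simp_all
  show "emeasure M E = emeasure N E"
  proof -
    have "coord n \<in> M \<rightarrow>\<^sub>M borel" "coord n \<in> N \<rightarrow>\<^sub>M borel" by measurable
    then show ?thesis
      using A emeasure_distr[of "coord n" M borel A] emeasure_distr[of "coord n" N borel A] eq[of n] sp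
      by metis
  qed
qed auto

locale weighted_map =
  fixes r :: "'a::topological_space \<Rightarrow> 'a" and V :: "'a \<Rightarrow> real"
  assumes r_meas [measurable]: "r \<in> borel \<rightarrow>\<^sub>M borel"
    and surj_r: "surj r"
    and V_meas [measurable]: "V \<in> borel_measurable borel"
    and V_nonneg: "0 \<le> V x"
begin

declare rhat_measurable[OF r_meas, measurable]

section \<open>Quasi-invariance and the fixed point equation\<close>

text \<open>
  The image of \<open>E\<close> under \<open>rhat r\<close> is the preimage of \<open>E\<close> under its inverse, so \<open>comp_rhat r M\<close> is the
  distribution of the left shift and the Radon--Nikodym condition becomes an equation of measures.
\<close>

lemma M_qi1_iff:
  "M \<in> M_qi1 V r \<longleftrightarrow> sets M = sets (B_inf r) \<and> emeasure M (proj_limit r) = 1 \<and>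
     distr M (B_inf r) lshift = density M (\<lambda>x. ennreal (V (coord 0 x)))"
proof -
  have "quasi_invariant V r M \<longleftrightarrow> distr M (B_inf r) lshift = density M (\<lambda>x. ennreal (V (coord 0 x)))"
    if M[measurable_cong]: "sets M = sets (B_inf r)" and fin: "finite_measure M"
  proof -
    interpret finite_measure M by fact
    have sp: "space M = proj_limit r" using sets_eq_imp_space_eq[OF M] by simp
    have comp: "comp_rhat r M = distr M (B_inf r) lshift"
    proof (rule measure_eqI)
      have sets_comp: "sets (comp_rhat r M) = sets M" by (simp add: comp_rhat_def)
      then show "sets (comp_rhat r M) = sets (distr M (B_inf r) lshift)" by (simp add: M)
      fix E assume "E \<in> sets (comp_rhat r M)"
      then have E: "E \<in> sets M" by (simp add: sets_comp)
      then have "E \<subseteq> proj_limit r" using sets.sets_into_space[OF E] sp by simp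
      then have "rhat r ` E = lshift -` E \<inter> proj_limit r"
        by (simp add: rhat_image_eq lshift_def[abs_def])
      then show "emeasure (comp_rhat r M) E = emeasure (distr M (B_inf r) lshift) E"
        using E M by (simp add: emeasure_comp_rhat emeasure_distr sp)
    qed
    have "density M (\<lambda>x. ennreal (V (coord 0 x))) = comp_rhat r M" if "quasi_invariant V r M"
    proof -
      have "density M (\<lambda>x. ennreal (V (coord 0 x))) = density M (RN_deriv M (comp_rhat r M))"
        using that by (intro density_cong) (auto simp: quasi_invariant_def)
      also have "\<dots> = comp_rhat r M"
        using that by (intro density_RN_deriv) (auto simp: quasi_invariant_def comp_rhat_def)
      finally show ?thesis .
    qed
    moreover have "quasi_invariant V r M"
      if *: "density M (\<lambda>x. ennreal (V (coord 0 x))) = comp_rhat r M"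
    proof -
      have "AE x in M. ennreal (V (coord 0 x)) = RN_deriv M (comp_rhat r M) x"
        by (rule RN_deriv_unique[OF _ *]) measurable
      moreover have "absolutely_continuous M (comp_rhat r M)"
        unfolding *[symmetric] by (rule absolutely_continuousI_density) measurable
      ultimately show ?thesis by (auto simp: quasi_invariant_def elim: eventually_mono)
    qed
    ultimately show ?thesis unfolding comp by metis
  qed
  moreover have "finite_measure M"
    if "sets M = sets (B_inf r)" "emeasure M (proj_limit r) = 1"
    using that sets_eq_imp_space_eq[OF that(1)] by (intro finite_measureI) simp
  ultimately show ?thesis unfolding M_qi1_def finite_measures_def by blast
qed

lemma M_fix1_iff:
  "N \<in> M_fix1 V r \<longleftrightarrow> sets N = sets borel \<and> emeasure N UNIV = 1 \<and>
     distr (density N (\<lambda>x. ennreal (V x))) borel r = N"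
proof -
  have "finite_measure N" if "sets N = sets (borel :: 'a measure)" "emeasure N UNIV = 1"
    using that sets_eq_imp_space_eq[OF that(1)] by (intro finite_measureI) simp
  then show ?thesis unfolding M_fix1_def finite_measures_def T_op_def by blast
qed

lemma
  assumes "M \<in> M_qi1 V r"
  shows qi_sets: "sets M = sets (B_inf r)"
    and qi_space: "space M = proj_limit r"
    and qi_distr: "distr M (B_inf r) lshift = density M (\<lambda>x. ennreal (V (coord 0 x)))"
    and qi_prob: "prob_space M"
proof -
  show 1: "sets M = sets (B_inf r)"
    and "distr M (B_inf r) lshift = density M (\<lambda>x. ennreal (V (coord 0 x)))"
    using assms by (simp_all add: M_qi1_iff)
  show "space M = proj_limit r" using sets_eq_imp_space_eq[OF 1] by simp
  then show "prob_space M" using assms by (intro prob_spaceI) (simp add: M_qi1_iff)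
qed

lemma
  assumes "N \<in> M_fix1 V r"
  shows fix_sets: "sets N = sets borel"
    and fix_space: "space N = UNIV"
    and fix_distr: "distr (density N (\<lambda>x. ennreal (V x))) borel r = N"
    and fix_prob: "prob_space N"
proof -
  show 1: "sets N = sets borel" and "distr (density N (\<lambda>x. ennreal (V x))) borel r = N"
    using assms by (simp_all add: M_fix1_iff)
  show "space N = UNIV" using sets_eq_imp_space_eq[OF 1] by simp
  then show "prob_space N" using assms by (intro prob_spaceI) (simp add: M_fix1_iff)
qed

lemma nn_integral_fix:
  assumes N: "N \<in> M_fix1 V r" and h[measurable]: "h \<in> borel_measurable borel"
  shows "(\<integral>\<^sup>+x. ennreal (V x) * h (r x) \<partial>N) = (\<integral>\<^sup>+x. h x \<partial>N)"
proof -
  note [measurable_cong] = fix_sets[OF N]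
  have "(\<integral>\<^sup>+x. h x \<partial>N) = (\<integral>\<^sup>+x. h x \<partial>distr (density N (\<lambda>x. ennreal (V x))) borel r)"
    by (simp add: fix_distr[OF N])
  also have "\<dots> = (\<integral>\<^sup>+x. ennreal (V x) * h (r x) \<partial>N)"
    by (simp add: nn_integral_distr nn_integral_density)
  finally show ?thesis by simp
qed

text \<open>
  The left shift pushes \<open>M\<close> forward to the weighted measure, and \<open>h\<close> is \<open>h \<circ> rhat r\<close> composed
  with the left shift.
\<close>

lemma nn_integral_qi:
  assumes M: "M \<in> M_qi1 V r" and h[measurable]: "h \<in> borel_measurable (B_inf r)"
  shows "(\<integral>\<^sup>+x. ennreal (V (coord 0 x)) * h (rhat r x) \<partial>M) = (\<integral>\<^sup>+x. h x \<partial>M)"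
proof -
  note [measurable_cong] = qi_sets[OF M]
  have "(\<integral>\<^sup>+x. ennreal (V (coord 0 x)) * h (rhat r x) \<partial>M)
      = (\<integral>\<^sup>+x. h (rhat r x) \<partial>distr M (B_inf r) lshift)"
    by (simp add: nn_integral_density qi_distr[OF M])
  also have "\<dots> = (\<integral>\<^sup>+x. h (rhat r (lshift x)) \<partial>M)"
    by (simp add: nn_integral_distr)
  also have "\<dots> = (\<integral>\<^sup>+x. h x \<partial>M)"
    by (rule nn_integral_cong) (simp add: qi_space[OF M] rhat_lshift)
  finally show ?thesis .
qed

section \<open>Marginals\<close>

text \<open>
  The density of the \<open>n\<close>-th marginal of a quasi-invariant measure relative to its marginal at \<open>0\<close>.
\<close>

definition cocycle :: "nat \<Rightarrow> 'a \<Rightarrow> ennreal" where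
  "cocycle n x = (\<Prod>k<n. ennreal (V ((r ^^ k) x)))"

lemma cocycle_measurable [measurable]: "cocycle n \<in> borel_measurable borel"
  unfolding cocycle_def[abs_def] by measurable

lemma cocycle_0 [simp]: "cocycle 0 = (\<lambda>x. 1)"
  by (simp add: cocycle_def fun_eq_iff)

lemma cocycle_Suc: "cocycle (Suc n) x = ennreal (V ((r ^^ n) x)) * cocycle n x"
  by (simp add: cocycle_def mult.commute)

lemma cocycle_Suc_shift: "cocycle (Suc n) x = ennreal (V x) * cocycle n (r x)"
  unfolding cocycle_def prod.lessThan_Suc_shift by (simp add: funpow_swap1)

text \<open>
  One application of \<open>rhat r\<close> lowers the index of the coordinate by one at the price of the factor
  \<open>V x\<^sub>0\<close>; this factor is a function of the lowered coordinate, since \<open>x\<^sub>0 = r\<^sup>n x\<^sub>n\<close>.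
\<close>

lemma nn_integral_coord_qi:
  assumes M: "M \<in> M_qi1 V r" and "h \<in> borel_measurable borel"
  shows "(\<integral>\<^sup>+x. h (coord n x) \<partial>M) = (\<integral>\<^sup>+x. cocycle n (coord 0 x) * h (coord 0 x) \<partial>M)"
  using assms(2)
proof (induction n arbitrary: h)
  case (Suc n)
  note [measurable] = Suc.prems
  have "(\<integral>\<^sup>+x. h (coord (Suc n) x) \<partial>M) = (\<integral>\<^sup>+x. ennreal (V (coord 0 x)) * h (coord n x) \<partial>M)"
    using nn_integral_qi[OF M, of "\<lambda>x. h (coord (Suc n) x)"] by (simp add: coord_Suc_rhat)
  also have "\<dots> = (\<integral>\<^sup>+x. ennreal (V ((r ^^ n) (coord n x))) * h (coord n x) \<partial>M)"
    by (rule nn_integral_cong) (use coord_shift_index[of _ r 0 n] in \<open>simp add: qi_space[OF M]\<close>)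
  also have "\<dots> = (\<integral>\<^sup>+x. cocycle n (coord 0 x) * (ennreal (V ((r ^^ n) (coord 0 x))) * h (coord 0 x)) \<partial>M)"
    by (rule Suc.IH) measurable
  finally show ?case by (simp add: cocycle_Suc ac_simps)
qed simp

lemma marginal_qi:
  assumes M: "M \<in> M_qi1 V r"
  shows "distr M borel (coord n) = density (distr M borel (coord 0)) (cocycle n)"
proof (rule measure_eqI)
  note [measurable_cong] = qi_sets[OF M]
  fix A assume "A \<in> sets (distr M borel (coord n))"
  then have A[measurable]: "A \<in> sets borel" by simp
  have "emeasure (distr M borel (coord n)) A = (\<integral>\<^sup>+y. indicator A y \<partial>distr M borel (coord n))"
    by simp
  also have "\<dots> = (\<integral>\<^sup>+x. indicator A (coord n x) \<partial>M)" by (rule nn_integral_distr) measurable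
  also have "\<dots> = (\<integral>\<^sup>+x. cocycle n (coord 0 x) * indicator A (coord 0 x) \<partial>M)"
    by (rule nn_integral_coord_qi[OF M]) measurable
  also have "\<dots> = emeasure (density (distr M borel (coord 0)) (cocycle n)) A"
    by (simp add: emeasure_density nn_integral_distr)
  finally show "emeasure (distr M borel (coord n)) A
    = emeasure (density (distr M borel (coord 0)) (cocycle n)) A" .
qed simp

text \<open>
  The fixed point equation is quasi-invariance tested on functions of \<open>x\<^sub>0\<close>, because
  \<open>coord 0 \<circ> rhat r = r \<circ> coord 0\<close>.
\<close>

lemma marginal_fix:
  assumes M: "M \<in> M_qi1 V r"
  shows "distr M borel (coord 0) \<in> M_fix1 V r"
  unfolding M_fix1_iff
proof (intro conjI)
  note [measurable_cong] = qi_sets[OF M]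
  interpret prob_space M by (rule qi_prob[OF M])
  show "emeasure (distr M borel (coord 0)) UNIV = 1"
    using emeasure_space_1 by (simp add: emeasure_distr qi_space[OF M])
  show "distr (density (distr M borel (coord 0)) (\<lambda>x. ennreal (V x))) borel r = distr M borel (coord 0)"
  proof (rule measure_eqI)
    fix A assume "A \<in> sets (distr (density (distr M borel (coord 0)) (\<lambda>x. ennreal (V x))) borel r)"
    then have [measurable]: "A \<in> sets borel" by simp
    have "emeasure (distr (density (distr M borel (coord 0)) (\<lambda>x. ennreal (V x))) borel r) A
      = (\<integral>\<^sup>+y. indicator A y \<partial>distr (density (distr M borel (coord 0)) (\<lambda>x. ennreal (V x))) borel r)"
      by simp
    also have "\<dots> = (\<integral>\<^sup>+x. ennreal (V (coord 0 x)) * indicator A (r (coord 0 x)) \<partial>M)"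
      by (simp add: nn_integral_distr nn_integral_density del: nn_integral_indicator)
    also have "\<dots> = (\<integral>\<^sup>+x. indicator A (coord 0 x) \<partial>M)"
      using nn_integral_qi[OF M, of "\<lambda>x. indicator A (coord 0 x)"] by (simp add: coord_0_rhat)
    also have "\<dots> = (\<integral>\<^sup>+y. indicator A y \<partial>distr M borel (coord 0))"
      by (rule nn_integral_distr[symmetric]) measurable
    finally show "emeasure (distr (density (distr M borel (coord 0)) (\<lambda>x. ennreal (V x))) borel r) A
        = emeasure (distr M borel (coord 0)) A" by simp
  qed simp
qed simp

lemma qi_eqI:
  assumes M: "M \<in> M_qi1 V r" and M': "M' \<in> M_qi1 V r"
    and eq: "distr M borel (coord 0) = distr M' borel (coord 0)"
  shows "M = M'"
proof (rule measure_eqI_marginals[OF r_meas])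
  interpret prob_space M by (rule qi_prob[OF M])
  show "finite_measure M" by (rule finite_measure_axioms)
  show "distr M borel (coord n) = distr M' borel (coord n)" for n
    using eq by (simp add: marginal_qi[OF M, of n] marginal_qi[OF M', of n])
qed (simp_all add: qi_sets M M')

section \<open>Lifting dominated fixed measures\<close>

text \<open>
  The prescribed marginals agree on cylinders written with different coordinates. Each step splits
  off the innermost factor \<open>V x\<close> of the cocycle, which the fixed point equation absorbs.
\<close>

lemma cocycle_consistent:
  assumes N: "N \<in> M_fix1 V r" and A: "A \<in> sets borel"
  shows "emeasure (density N (cocycle (n + k))) ((r ^^ k) -` A) = emeasure (density N (cocycle n)) A"
proof (induction k)
  case (Suc k)
  note [measurable_cong] = fix_sets[OF N]
  define B where "B = (r ^^ k) -` A"
  have B[measurable]: "B \<in> sets borel"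
    unfolding B_def by (rule funpow_vimage_borel[OF r_meas A])
  have pre: "(r ^^ Suc k) -` A = r -` B" by (auto simp: B_def funpow_swap1)
  have rB: "r -` B \<in> sets borel" using measurable_sets[OF r_meas B] by simp
  have "emeasure (density N (cocycle (Suc (n + k)))) (r -` B)
      = (\<integral>\<^sup>+x. ennreal (V x) * (cocycle (n + k) (r x) * indicator B (r x)) \<partial>N)"
    using rB by (subst emeasure_density)
      (auto simp: cocycle_Suc_shift fix_sets[OF N] indicator_def mult.assoc intro!: nn_integral_cong)
  also have "\<dots> = (\<integral>\<^sup>+x. cocycle (n + k) x * indicator B x \<partial>N)"
    by (rule nn_integral_fix[OF N]) measurable
  also have "\<dots> = emeasure (density N (cocycle (n + k))) B"
    by (simp add: emeasure_density)
  also have "\<dots> = emeasure (density N (cocycle n)) A" using Suc by (simp add: B_def)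
  finally show ?case by (simp only: pre add_Suc_right)
qed simp

text \<open>
  The same cylinder can be written over many coordinates; any choice serves, by
  \<open>cocycle_consistent\<close>, and the least one is taken.
\<close>

definition cyl_mass :: "'a measure \<Rightarrow> (nat \<Rightarrow> 'a) set \<Rightarrow> ennreal" where
  "cyl_mass N E =
     (let n = (LEAST n. \<exists>A\<in>sets borel. E = coord n -` A \<inter> proj_limit r)
      in emeasure (density N (cocycle n)) (coord n ` E))"

lemma coord_image_cylinder: "coord n ` (coord n -` A \<inter> proj_limit r) = A"
  using coord_onto[OF surj_r, of n] by force

text \<open>
  Since the coordinates are onto, the base of a cylinder is recovered as its image; so two
  representations of the same cylinder differ only by a preimage under a power of \<open>r\<close>.
\<close>

lemma cyl_mass_cylinder:
  assumes N: "N \<in> M_fix1 V r" and A: "A \<in> sets borel"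
  shows "cyl_mass N (coord n -` A \<inter> proj_limit r) = emeasure (density N (cocycle n)) A"
proof -
  define E where "E = coord n -` A \<inter> proj_limit r"
  define P where "P m \<longleftrightarrow> (\<exists>B\<in>sets borel. E = coord m -` B \<inter> proj_limit r)" for m
  define m where "m = (LEAST m. P m)"
  have "P n" using A by (auto simp: P_def E_def)
  then have "P m" "m \<le> n" unfolding m_def by (auto intro: LeastI Least_le)
  then obtain B k where B: "B \<in> sets borel" "E = coord m -` B \<inter> proj_limit r" and k: "n = m + k"
    unfolding P_def by (auto simp: le_iff_add)
  have "A = coord n ` E" by (simp add: E_def coord_image_cylinder)
  also have "E = coord n -` ((r ^^ k) -` B) \<inter> proj_limit r"
    unfolding B(2) k by (rule cylinder_raise)
  finally have "A = (r ^^ k) -` B" by (simp add: coord_image_cylinder)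
  then have "emeasure (density N (cocycle n)) A = emeasure (density N (cocycle m)) B"
    using cocycle_consistent[OF N B(1), of m k] by (simp add: k)
  also have "B = coord m ` E" by (simp add: B(2) coord_image_cylinder)
  also have "emeasure (density N (cocycle m)) (coord m ` E) = cyl_mass N E"
    by (simp add: cyl_mass_def m_def P_def Let_def)
  finally show ?thesis by (simp add: E_def)
qed

text \<open>
  Caratheodory extension of \<open>cyl_mass N\<close> requires continuity at the empty set along decreasing
  cylinders. The bound \<open>cyl_mass N E \<le> C M(E)\<close> on cylinders, inherited from \<open>N \<le> C M\<^sub>0\<close> because
  the marginals of both arise from the same cocycle, transfers it from the measure \<open>M\<close>; here
  \<open>M\<^sub>0\<close> is the marginal of \<open>M\<close> at \<open>0\<close>.
\<close>

lemma lift_dominated: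
  fixes C :: real
  assumes M: "M \<in> M_qi1 V r" and N: "N \<in> M_fix1 V r"
    and le: "\<And>A. A \<in> sets borel \<Longrightarrow> emeasure N A \<le> ennreal C * emeasure (distr M borel (coord 0)) A"
  obtains L where "L \<in> M_qi1 V r" "distr L borel (coord 0) = N"
proof -
  note [measurable_cong] = qi_sets[OF M] fix_sets[OF N]
  interpret M: prob_space M by (rule qi_prob[OF M])
  interpret R: ring_of_sets "proj_limit r" "cylinders r" by (rule cylinders_ring[OF r_meas])
  let ?M0 = "distr M borel (coord 0)"
  have cyl_sets: "E \<in> sets M" if "E \<in> cylinders r" for E
    using that by (simp add: qi_sets[OF M] sets_B_inf_cylinders)
  have mass_le: "cyl_mass N E \<le> ennreal C * emeasure M E" if E: "E \<in> cylinders r" for E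
  proof -
    obtain n A where A: "A \<in> sets borel" "E = coord n -` A \<inter> proj_limit r"
      using E unfolding cylinders_def by blast
    note [measurable] = A(1)
    have "N \<le> scale_measure (ennreal C) ?M0"
      by (subst le_measure) (simp_all add: fix_sets[OF N] le)
    then have "(\<integral>\<^sup>+x. cocycle n x * indicator A x \<partial>N)
        \<le> (\<integral>\<^sup>+x. cocycle n x * indicator A x \<partial>scale_measure (ennreal C) ?M0)"
      by (intro nn_integral_mono_measure) (simp_all add: fix_sets[OF N])
    also have "\<dots> = ennreal C * (\<integral>\<^sup>+x. cocycle n x * indicator A x \<partial>?M0)"
      by (rule nn_integral_scale_measure) measurable
    finally have "emeasure (density N (cocycle n)) A \<le> ennreal C * emeasure (density ?M0 (cocycle n)) A"
      by (simp add: emeasure_density)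
    also have "emeasure (density ?M0 (cocycle n)) A = emeasure M E"
      unfolding marginal_qi[OF M, symmetric] A(2) by (simp add: emeasure_distr qi_space[OF M])
    finally show ?thesis using A by (simp add: cyl_mass_cylinder[OF N])
  qed
  have "\<exists>\<mu>. (\<forall>E\<in>cylinders r. \<mu> E = cyl_mass N E) \<and>
      measure_space (proj_limit r) (sigma_sets (proj_limit r) (cylinders r)) \<mu>"
  proof (rule R.caratheodory_empty_continuous)
    show "positive (cylinders r) (cyl_mass N)"
      using mass_le[of "{}"] R.empty_sets by (simp add: positive_def)
    show "additive (cylinders r) (cyl_mass N)"
      unfolding additive_def
    proof (intro ballI impI)
      fix E F assume "E \<in> cylinders r" "F \<in> cylinders r" and disj: "E \<inter> F = {}"
      then obtain n A B where AB: "A \<in> sets borel" "B \<in> sets borel"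
        "E = coord n -` A \<inter> proj_limit r" "F = coord n -` B \<inter> proj_limit r"
        using cylinders_common[OF r_meas] by metis
      have "A \<inter> B = coord n ` (E \<inter> F)"
      proof -
        have "E \<inter> F = coord n -` (A \<inter> B) \<inter> proj_limit r" using AB by auto
        then show ?thesis by (simp only: coord_image_cylinder)
      qed
      then have "A \<inter> B = {}" by (simp add: disj)
      have EF: "E \<union> F = coord n -` (A \<union> B) \<inter> proj_limit r" using AB by auto
      show "cyl_mass N (E \<union> F) = cyl_mass N E + cyl_mass N F"
        unfolding EF using AB \<open>A \<inter> B = {}\<close>
        by (simp add: cyl_mass_cylinder[OF N] plus_emeasure fix_sets[OF N] del: vimage_Un)
    qed
    show "cyl_mass N E \<noteq> \<infinity>" if "E \<in> cylinders r" for E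
    proof -
      have "ennreal C * emeasure M E < top"
        by (simp add: M.emeasure_eq_measure ennreal_mult_less_top)
      with mass_le[OF that] show ?thesis by (auto dest: le_less_trans)
    qed
    fix E :: "nat \<Rightarrow> (nat \<Rightarrow> 'a) set"
    assume E: "range E \<subseteq> cylinders r" "decseq E" "(\<Inter>i. E i) = {}"
    have "(\<lambda>i. emeasure M (E i)) \<longlonglongrightarrow> emeasure M (\<Inter>i. E i)"
      by (rule Lim_emeasure_decseq) (use E cyl_sets in auto)
    then have "(\<lambda>i. ennreal C * emeasure M (E i)) \<longlonglongrightarrow> ennreal C * 0"
      by (intro ennreal_tendsto_cmult) (simp_all add: E)
    then have lim: "(\<lambda>i. ennreal C * emeasure M (E i)) \<longlonglongrightarrow> 0" by simp
    show "(\<lambda>i. cyl_mass N (E i)) \<longlonglongrightarrow> 0"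
    proof (rule tendsto_sandwich[OF _ _ tendsto_const lim])
      show "\<forall>\<^sub>F i in sequentially. cyl_mass N (E i) \<le> ennreal C * emeasure M (E i)"
        using E(1) by (intro always_eventually allI mass_le) auto
    qed simp
  qed
  then obtain \<mu> where \<mu>: "\<And>E. E \<in> cylinders r \<Longrightarrow> \<mu> E = cyl_mass N E"
    and ms: "measure_space (proj_limit r) (sigma_sets (proj_limit r) (cylinders r)) \<mu>" by blast
  define L where "L = measure_of (proj_limit r) (cylinders r) \<mu>"
  have L_sets[measurable_cong]: "sets L = sets (B_inf r)"
    by (simp add: L_def sets_B_inf_cylinders R.space_closed)
  have L_space: "space L = proj_limit r"
    by (simp add: L_def R.space_closed)
  have L_cyl: "emeasure L E = cyl_mass N E" if "E \<in> cylinders r" for E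
  proof -
    have "emeasure L E = \<mu> E"
    proof (rule emeasure_measure_of[OF L_def R.space_closed])
      show "E \<in> sets L" using that by (simp add: L_sets sets_B_inf_cylinders)
      show "positive (sets L) \<mu>" "countably_additive (sets L) \<mu>"
        using ms by (simp_all add: L_sets sets_B_inf_cylinders measure_space_def)
    qed
    then show ?thesis using \<mu>[OF that] by simp
  qed
  have L_marginal: "distr L borel (coord n) = density N (cocycle n)" for n
  proof (rule measure_eqI)
    fix A assume "A \<in> sets (distr L borel (coord n))"
    then have A[measurable]: "A \<in> sets borel" by simp
    have "emeasure (distr L borel (coord n)) A = emeasure L (coord n -` A \<inter> proj_limit r)"
      by (simp add: emeasure_distr L_space)
    also have "\<dots> = cyl_mass N (coord n -` A \<inter> proj_limit r)"
      by (rule L_cyl) (unfold cylinders_def, use A in blast)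
    finally show "emeasure (distr L borel (coord n)) A = emeasure (density N (cocycle n)) A"
      by (simp add: cyl_mass_cylinder[OF N A])
  qed (simp add: fix_sets[OF N])
  have L0: "distr L borel (coord 0) = N"
    using L_marginal[of 0] by (simp add: density_1)
  have L1: "emeasure L (proj_limit r) = 1"
  proof -
    have "emeasure L (proj_limit r) = emeasure (distr L borel (coord 0)) UNIV"
      by (simp add: emeasure_distr L_space)
    also have "\<dots> = 1" unfolding L0 using N by (simp only: M_fix1_iff)
    finally show ?thesis .
  qed
  have "distr L (B_inf r) lshift = density L (\<lambda>x. ennreal (V (coord 0 x)))"
  proof (rule measure_eqI_marginals[OF r_meas])
    interpret L: prob_space L by (rule prob_spaceI) (simp add: L_space L1)
    show "finite_measure (distr L (B_inf r) lshift)" by (rule L.finite_measure_distr) measurable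
    fix n
    show "distr (distr L (B_inf r) lshift) borel (coord n)
        = distr (density L (\<lambda>x. ennreal (V (coord 0 x)))) borel (coord n)"
    proof (rule measure_eqI)
      fix A assume "A \<in> sets (distr (distr L (B_inf r) lshift) borel (coord n))"
      then have A[measurable]: "A \<in> sets borel" by simp
      have "emeasure (distr (distr L (B_inf r) lshift) borel (coord n)) A
          = emeasure (distr L borel (coord (Suc n))) A"
        by (simp add: distr_distr comp_def coord_lshift)
      also have "\<dots> = (\<integral>\<^sup>+x. ennreal (V ((r ^^ n) x)) * (cocycle n x * indicator A x) \<partial>N)"
        by (simp add: L_marginal emeasure_density cocycle_Suc mult.assoc)
      also have "\<dots> = (\<integral>\<^sup>+x. ennreal (V ((r ^^ n) x)) * indicator A x \<partial>distr L borel (coord n))"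
        unfolding L_marginal by (subst nn_integral_density) (auto simp: ac_simps)
      also have "\<dots> = (\<integral>\<^sup>+x. ennreal (V ((r ^^ n) (coord n x))) * indicator A (coord n x) \<partial>L)"
        by (rule nn_integral_distr) measurable
      also have "\<dots> = (\<integral>\<^sup>+x. ennreal (V (coord 0 x)) * indicator A (coord n x) \<partial>L)"
        by (rule nn_integral_cong) (use coord_shift_index[of _ r 0 n] in \<open>simp add: L_space\<close>)
      also have "\<dots> = (\<integral>\<^sup>+y. indicator A y \<partial>distr (density L (\<lambda>x. ennreal (V (coord 0 x)))) borel (coord n))"
        by (simp add: nn_integral_distr nn_integral_density del: nn_integral_indicator)
      finally show "emeasure (distr (distr L (B_inf r) lshift) borel (coord n)) A
          = emeasure (distr (density L (\<lambda>x. ennreal (V (coord 0 x)))) borel (coord n)) A"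
        by simp
    qed simp
  qed (simp_all add: L_sets)
  then have "L \<in> M_qi1 V r" by (simp add: M_qi1_iff L_sets L1)
  then show thesis using L0 by (rule that)
qed

section \<open>Extremality of the lifted and the projected measure\<close>

text \<open>
  The characterisation \<open>M_qi1_iff\<close> is linear in the measure.
\<close>

lemma qi_mixture:
  assumes L: "L \<in> M_qi1 V r" and L': "L' \<in> M_qi1 V r" and t: "0 \<le> (t::real)" "t \<le> 1"
  obtains K where "K \<in> M_qi1 V r"
    "\<And>A. A \<in> sets (B_inf r) \<Longrightarrow> emeasure K A = ennreal t * emeasure L A + ennreal (1 - t) * emeasure L' A"
proof -
  note [measurable_cong] = qi_sets[OF L] qi_sets[OF L']
  obtain K where sets_K: "sets K = sets L" and int_K:
    "\<And>h. h \<in> borel_measurable L \<Longrightarrow>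
      (\<integral>\<^sup>+x. h x \<partial>K) = ennreal t * (\<integral>\<^sup>+x. h x \<partial>L) + ennreal (1 - t) * (\<integral>\<^sup>+x. h x \<partial>L')"
    using mixture[OF qi_prob[OF L] qi_prob[OF L'] _ t] by (metis qi_sets L L')
  have K[measurable_cong]: "sets K = sets (B_inf r)" by (simp add: sets_K qi_sets[OF L])
  have K_eq: "emeasure K A = ennreal t * emeasure L A + ennreal (1 - t) * emeasure L' A"
    if [measurable]: "A \<in> sets (B_inf r)" for A
    using int_K[of "indicator A"] by simp
  have "emeasure K (proj_limit r) = ennreal t + ennreal (1 - t)"
    using K_eq[of "proj_limit r"] sets.top[of "B_inf r"] L L' by (simp add: M_qi1_iff)
  also have "\<dots> = 1" using t by (simp add: ennreal_plus[symmetric] del: ennreal_plus)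
  finally have K1: "emeasure K (proj_limit r) = 1" .
  have "distr K (B_inf r) lshift = density K (\<lambda>x. ennreal (V (coord 0 x)))"
  proof (rule measure_eqI)
    fix E assume "E \<in> sets (distr K (B_inf r) lshift)"
    then have [measurable]: "E \<in> sets (B_inf r)" by simp
    have *: "(\<integral>\<^sup>+x. indicator E (lshift x) \<partial>M) = (\<integral>\<^sup>+x. ennreal (V (coord 0 x)) * indicator E x \<partial>M)"
      if "M \<in> M_qi1 V r" for M
      using nn_integral_qi[OF that, of "\<lambda>x. indicator E (lshift x)"] by (simp add: lshift_rhat)
    have "emeasure (distr K (B_inf r) lshift) E = (\<integral>\<^sup>+y. indicator E y \<partial>distr K (B_inf r) lshift)"
      by simp
    also have "\<dots> = (\<integral>\<^sup>+x. indicator E (lshift x) \<partial>K)"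
      by (rule nn_integral_distr) measurable
    also have "\<dots> = (\<integral>\<^sup>+x. ennreal (V (coord 0 x)) * indicator E x \<partial>K)"
      by (simp add: int_K * L L')
    also have "\<dots> = emeasure (density K (\<lambda>x. ennreal (V (coord 0 x)))) E"
      by (rule emeasure_density[symmetric]) measurable
    finally show "emeasure (distr K (B_inf r) lshift) E = \<dots>" .
  qed (simp add: K)
  then have "K \<in> M_qi1 V r" by (simp add: M_qi1_iff K K1)
  then show thesis using K_eq by (rule that)
qed

text \<open>
  A decomposition of \<open>M\<close> projects to one of its marginal, and the projection is injective. A
  decomposition of the marginal lifts componentwise; the mixture of the lifts is quasi-invariant with
  the same marginal as \<open>M\<close>, hence equal to \<open>M\<close>.
\<close>

theorem extreme_qi_iff_extreme_fix:
  assumes M: "M \<in> M_qi1 V r"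
  shows "extreme_measure M (M_qi1 V r) \<longleftrightarrow> extreme_measure (distr M borel (coord 0)) (M_fix1 V r)"
proof
  let ?N = "distr M borel (coord 0)"
  note [measurable_cong] = qi_sets[OF M]
  have em: "emeasure (distr L borel (coord 0)) A = emeasure L (coord 0 -` A \<inter> proj_limit r)"
    if "L \<in> M_qi1 V r" "A \<in> sets borel" for L A
    using that by (simp add: emeasure_distr qi_space measurable_cong_sets[OF qi_sets refl])
  have cyl: "coord 0 -` A \<inter> proj_limit r \<in> sets (B_inf r)" if "A \<in> sets borel" for A
    using measurable_sets[OF coord_measurable that] by simp
  show "extreme_measure M (M_qi1 V r)" if ext: "extreme_measure ?N (M_fix1 V r)"
  proof (rule extreme_measureI[OF M])
    fix L L' and t :: real
    assume L: "L \<in> M_qi1 V r" and L': "L' \<in> M_qi1 V r" and t: "0 < t" "t < 1"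
      and eq: "\<And>A. A \<in> sets M \<Longrightarrow> emeasure M A = ennreal t * emeasure L A + ennreal (1 - t) * emeasure L' A"
    have "distr L borel (coord 0) = ?N"
      by (rule extreme_measureD(1)[OF ext marginal_fix[OF L] marginal_fix[OF L'] t])
         (simp add: em M L L' cyl eq qi_sets[OF M])
    then show "L = M" by (rule qi_eqI[OF L M])
  qed
  show "extreme_measure ?N (M_fix1 V r)" if ext: "extreme_measure M (M_qi1 V r)"
  proof (rule extreme_measureI[OF marginal_fix[OF M]])
    fix N N' and t :: real
    assume N: "N \<in> M_fix1 V r" and N': "N' \<in> M_fix1 V r" and t: "0 < t" "t < 1"
      and "\<And>A. A \<in> sets ?N \<Longrightarrow> emeasure ?N A = ennreal t * emeasure N A + ennreal (1 - t) * emeasure N' A"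
    then have eq: "\<And>A. A \<in> sets borel \<Longrightarrow> emeasure ?N A = ennreal t * emeasure N A + ennreal (1 - t) * emeasure N' A"
      by simp
    obtain L where L: "L \<in> M_qi1 V r" and L0: "distr L borel (coord 0) = N"
      by (rule lift_dominated[OF M N dominated_summand[OF t(1) eq]])
    have "emeasure N' A \<le> ennreal (1 / (1 - t)) * emeasure ?N A" if "A \<in> sets borel" for A
      using eq[OF that] t by (intro dominated_summand[where N' = N]) (simp_all add: add.commute)
    then obtain L' where L': "L' \<in> M_qi1 V r" and L'0: "distr L' borel (coord 0) = N'"
      by (rule lift_dominated[OF M N'])
    obtain K where K: "K \<in> M_qi1 V r" and K_eq:
      "\<And>A. A \<in> sets (B_inf r) \<Longrightarrow> emeasure K A = ennreal t * emeasure L A + ennreal (1 - t) * emeasure L' A"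
      using qi_mixture[OF L L', of t] t by auto
    have "distr K borel (coord 0) = ?N"
    proof (rule measure_eqI)
      fix A assume "A \<in> sets (distr K borel (coord 0))"
      then have A: "A \<in> sets borel" by simp
      have "emeasure (distr K borel (coord 0)) A
          = ennreal t * emeasure (distr L borel (coord 0)) A + ennreal (1 - t) * emeasure (distr L' borel (coord 0)) A"
        by (simp add: em A K L L' K_eq cyl)
      also have "\<dots> = emeasure ?N A" by (simp only: L0 L'0 eq[OF A])
      finally show "emeasure (distr K borel (coord 0)) A = emeasure ?N A" .
    qed simp
    then have "K = M" by (rule qi_eqI[OF K M])
    then have "L = M"
      using K_eq by (intro extreme_measureD(1)[OF ext L L' t]) (simp add: qi_sets[OF M])
    then show "N = ?N" using L0 by simp
  qed
qed

section \<open>Extremality and ergodicity\<close>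

text \<open>
  Pushing \<open>g dM\<close> forward by the left shift gives \<open>W (g \<circ> rhat r) dM\<close>, while quasi-invariance asks for
  \<open>W g dM\<close>, where \<open>W = V \<circ> coord 0\<close>.
\<close>

lemma qi_density_iff:
  assumes M: "M \<in> M_qi1 V r" and g: "g \<in> borel_measurable (B_inf r)"
  shows "density M g \<in> M_qi1 V r \<longleftrightarrow> (\<integral>\<^sup>+x. g x \<partial>M) = 1 \<and>
    (AE x in M. ennreal (V (coord 0 x)) * g (rhat r x) = ennreal (V (coord 0 x)) * g x)"
proof -
  note [measurable_cong] = qi_sets[OF M] and [measurable] = g
  interpret prob_space M by (rule qi_prob[OF M])
  have "distr (density M g) (B_inf r) lshift = density M (\<lambda>x. ennreal (V (coord 0 x)) * g (rhat r x))"
  proof (rule measure_eqI)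
    fix E assume "E \<in> sets (distr (density M g) (B_inf r) lshift)"
    then have [measurable]: "E \<in> sets (B_inf r)" by simp
    have "emeasure (distr (density M g) (B_inf r) lshift) E
        = (\<integral>\<^sup>+y. indicator E y \<partial>distr (density M g) (B_inf r) lshift)"
      by simp
    also have "\<dots> = (\<integral>\<^sup>+x. g x * indicator E (lshift x) \<partial>M)"
      by (simp add: nn_integral_distr nn_integral_density del: nn_integral_indicator)
    also have "\<dots> = (\<integral>\<^sup>+x. ennreal (V (coord 0 x)) * g (rhat r x) * indicator E x \<partial>M)"
      using nn_integral_qi[OF M, of "\<lambda>x. g x * indicator E (lshift x)"]
      by (simp add: lshift_rhat mult.assoc)
    also have "\<dots> = emeasure (density M (\<lambda>x. ennreal (V (coord 0 x)) * g (rhat r x))) E"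
      by (rule emeasure_density[symmetric]) measurable
    finally show "emeasure (distr (density M g) (B_inf r) lshift) E = \<dots>" .
  qed (simp add: qi_sets[OF M])
  moreover have "density (density M g) (\<lambda>x. ennreal (V (coord 0 x)))
      = density M (\<lambda>x. ennreal (V (coord 0 x)) * g x)"
    by (simp add: density_density_eq mult.commute)
  moreover have "emeasure (density M g) (proj_limit r) = (\<integral>\<^sup>+x. g x \<partial>M)"
    using sets.top[of M] by (simp add: emeasure_density qi_space[OF M, symmetric] cong: nn_integral_cong)
  ultimately show ?thesis
    by (simp add: M_qi1_iff qi_sets[OF M] density_unique_iff)
qed

lemma AE_lshift:
  assumes M: "M \<in> M_qi1 V r"
    and "AE x in density M (\<lambda>x. ennreal (V (coord 0 x))). P x"
  shows "AE x in M. P (lshift x)"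
proof -
  note [measurable_cong] = qi_sets[OF M]
  have "AE x in distr M (B_inf r) lshift. P x"
    using assms(2) unfolding qi_distr[OF M] .
  then show ?thesis by (rule AE_distrD[rotated]) measurable
qed

text \<open>
  By quasi-invariance the weighted measure of \<open>A\<close> is the measure of \<open>rhat r ` A\<close>.
\<close>

lemma emeasure_weighted_invariant:
  assumes M: "M \<in> M_qi1 V r" and A: "A \<in> sets M" "rhat r ` A = A"
  shows "emeasure (density M (\<lambda>x. ennreal (V (coord 0 x)))) A = emeasure M A"
proof -
  note [measurable_cong] = qi_sets[OF M]
  have "A \<subseteq> proj_limit r" using sets.sets_into_space[OF A(1)] by (simp add: qi_space[OF M])
  then have "lshift -` A \<inter> proj_limit r = A"
    using A(2) by (simp add: rhat_image_eq lshift_def[abs_def])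
  then show ?thesis
    using A(1) by (simp add: qi_distr[OF M, symmetric] emeasure_distr qi_space[OF M] qi_sets[OF M])
qed

lemma extreme_imp_ergodic:
  assumes ext: "extreme_measure M (M_qi1 V r)"
  shows "ergodic_for (density M (\<lambda>x. ennreal (V (coord 0 x)))) (rhat r)"
  unfolding ergodic_for_def
proof (intro ballI impI)
  have M: "M \<in> M_qi1 V r" using ext by (simp add: extreme_measure_def)
  note [measurable_cong] = qi_sets[OF M]
  let ?D = "density M (\<lambda>x. ennreal (V (coord 0 x)))"
  fix A assume "A \<in> sets ?D" and inv: "rhat r ` A = A"
  then have A[measurable]: "A \<in> sets M" by simp
  have "rhat r x \<in> A \<longleftrightarrow> x \<in> A" for x
    using inv lshift_rhat by (metis imageE imageI)
  then have ind: "indicator A (rhat r x) = (indicator A x :: real)" for x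
    by (simp add: indicator_def)
  have "\<exists>c. AE x in M. indicator A x = (c::real)"
  proof (rule extreme_measure_bounded_const[OF ext qi_prob[OF M], where C = 1])
    show "density M (\<lambda>x. ennreal (a + b * indicator A x)) \<in> M_qi1 V r"
      if "(\<integral>\<^sup>+x. ennreal (a + b * indicator A x) \<partial>M) = 1" for a b
      using that by (subst qi_density_iff[OF M]) (simp_all add: ind qi_sets[OF M, symmetric])
  qed (auto simp: indicator_def)
  then obtain c :: real where c: "AE x in M. indicator A x = c" by blast
  have ac: "emeasure ?D B = 0" if [measurable]: "B \<in> sets M" and "AE x in M. x \<notin> B" for B
  proof -
    have "(\<integral>\<^sup>+x. ennreal (V (coord 0 x)) * indicator B x \<partial>M) = 0"
      by (subst nn_integral_0_iff_AE) (use that(2) in \<open>auto elim: eventually_mono\<close>)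
    then show ?thesis by (simp add: emeasure_density)
  qed
  show "emeasure ?D A = 0 \<or> emeasure ?D (space ?D - A) = 0"
  proof (cases "c = 1")
    case True
    with c have "AE x in M. x \<notin> space M - A"
      by (auto elim!: eventually_mono simp: indicator_def split: if_splits)
    then show ?thesis using ac[of "space M - A"] by simp
  next
    case False
    with c have "AE x in M. x \<notin> A"
      by (auto elim!: eventually_mono simp: indicator_def split: if_splits)
    then show ?thesis using ac[of A] by simp
  qed
qed

text \<open>
  Quasi-invariance gives \<open>F \<circ> rhat r = F\<close> only almost everywhere for the weighted measure, and where
  \<open>V\<close> vanishes this says nothing. But the left shift pulls null sets of the weighted measure back to
  null sets of \<open>M\<close>, so \<open>F\<close> is constant along almost every forward orbit of the left shift. The set
  where \<open>F \<le> 1\<close> holds eventually along the orbit is therefore a strictly invariant version of the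
  level set \<open>F \<le> 1\<close>.
\<close>

lemma ergodic_density_const:
  fixes F :: "(nat \<Rightarrow> 'a) \<Rightarrow> real"
  assumes erg: "ergodic_for (density M (\<lambda>x. ennreal (V (coord 0 x)))) (rhat r)"
    and M: "M \<in> M_qi1 V r" and D: "density M (\<lambda>x. ennreal (F x)) \<in> M_qi1 V r"
    and F: "F \<in> borel_measurable M" and F0: "\<And>x. 0 \<le> F x"
  shows "density M (\<lambda>x. ennreal (F x)) = M"
proof -
  note [measurable_cong] = qi_sets[OF M] and [measurable] = F
  interpret prob_space M by (rule qi_prob[OF M])
  let ?D = "density M (\<lambda>x. ennreal (V (coord 0 x)))"
  have F_B[measurable]: "F \<in> borel_measurable (B_inf r)" by measurable
  have int1: "(\<integral>\<^sup>+x. ennreal (F x) \<partial>M) = 1"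
    and inv: "AE x in M. ennreal (V (coord 0 x)) * ennreal (F (rhat r x))
                 = ennreal (V (coord 0 x)) * ennreal (F x)"
    using D by (simp_all add: qi_density_iff[OF M])
  have "AE x in ?D. F (rhat r x) = F x"
    using inv by (subst AE_density) (auto elim!: eventually_mono simp: V_nonneg F0 ennreal_mult[symmetric])
  then have "AE x in M. F (rhat r (lshift x)) = F (lshift x)" by (rule AE_lshift[OF M])
  then have step: "AE x in M. F (lshift x) = F x"
    using AE_space by eventually_elim (simp add: qi_space[OF M] rhat_lshift)
  have "AE x in M. F ((lshift ^^ k) x) = F x" for k
  proof (induction k)
    case (Suc k)
    have "AE x in M. F ((lshift ^^ k) (lshift x)) = F (lshift x)"
      by (rule AE_lshift[OF M]) (use Suc in \<open>auto simp: AE_density elim: eventually_mono\<close>)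
    with step show ?case by eventually_elim (simp add: funpow_swap1)
  qed simp
  then have const: "AE x in M. \<forall>k. F ((lshift ^^ k) x) = F x"
    by (simp add: AE_all_countable)
  \<comment> \<open>\<open>F \<le> 1\<close> eventually along the orbit: unaffected by dropping the first point of the orbit\<close>
  define A where "A = {x \<in> space M. \<exists>n. \<forall>k\<ge>n. F ((lshift ^^ k) x) \<le> 1}"
  have lp[measurable]: "lshift ^^ k \<in> M \<rightarrow>\<^sub>M M" for k
    by (rule measurable_compose_n) measurable
  have A_meas: "A \<in> sets M" unfolding A_def by measurable
  have A_sub: "A \<subseteq> proj_limit r" by (auto simp: A_def qi_space[OF M])
  have "lshift x \<in> A \<longleftrightarrow> x \<in> A" if x: "x \<in> proj_limit r" for x
  proof -
    have "(\<exists>n. \<forall>k\<ge>n. F ((lshift ^^ k) (lshift x)) \<le> 1) \<longleftrightarrow> (\<exists>n. \<forall>k\<ge>n. F ((lshift ^^ k) x) \<le> 1)"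
      using eventually_sequentially_Suc[of "\<lambda>k. F ((lshift ^^ k) x) \<le> 1"]
      by (simp add: eventually_sequentially funpow_swap1)
    then show ?thesis using x by (simp add: A_def qi_space[OF M] lshift_in)
  qed
  then have "lshift -` A \<inter> proj_limit r = A" using A_sub by auto
  then have A_inv: "rhat r ` A = A"
    using A_sub by (simp add: rhat_image_eq lshift_def[abs_def])
  have A_iff: "AE x in M. x \<in> A \<longleftrightarrow> F x \<le> 1"
    using const AE_space by eventually_elim (auto simp: A_def)
  have int: "integrable M F"
    using int1 by (intro integrableI_nonneg) (auto simp: F0)
  have mean: "(\<integral>x. F x \<partial>M) = 1"
    using int1 nn_integral_eq_integral[OF int] F0 by simp
  have "AE x in M. F x = 1"
  proof -
    have "emeasure ?D A = 0 \<or> emeasure ?D (space ?D - A) = 0"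
      using erg A_meas A_inv unfolding ergodic_for_def by simp
    then show ?thesis
    proof
      assume "emeasure ?D A = 0"
      then have "emeasure M A = 0"
        using emeasure_weighted_invariant[OF M A_meas A_inv] by simp
      then have "AE x in M. x \<notin> A"
        using A_meas by (intro AE_not_in null_setsI)
      with A_iff have gt: "AE x in M. 1 < F x" by eventually_elim auto
      have "(\<integral>x. F x - 1 \<partial>M) = 0" using int mean by (simp add: prob_space)
      then have "AE x in M. F x - 1 = 0"
        using int gt by (subst (asm) integral_nonneg_eq_0_iff_AE) (auto elim: eventually_mono)
      then show ?thesis by eventually_elim simp
    next
      assume *: "emeasure ?D (space ?D - A) = 0"
      have "rhat r ` (space M - A) = space M - A"
        using \<open>lshift -` A \<inter> proj_limit r = A\<close>
        by (subst rhat_image_eq) (auto simp: qi_space[OF M] lshift_def[abs_def, symmetric] lshift_in)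
      then have "emeasure M (space M - A) = 0"
        using emeasure_weighted_invariant[OF M, of "space M - A"] A_meas * by simp
      then have "AE x in M. x \<notin> space M - A"
        using A_meas by (intro AE_not_in null_setsI) auto
      with A_iff have le: "AE x in M. F x \<le> 1" using AE_space by eventually_elim auto
      have "(\<integral>x. 1 - F x \<partial>M) = 0" using int mean by (simp add: prob_space)
      then have "AE x in M. 1 - F x = 0"
        using int le by (subst (asm) integral_nonneg_eq_0_iff_AE) (auto elim: eventually_mono)
      then show ?thesis by eventually_elim simp
    qed
  qed
  then have "density M (\<lambda>x. ennreal (F x)) = density M (\<lambda>x. 1)"
    by (intro density_cong) (auto elim: eventually_mono)
  then show ?thesis by (simp add: density_1)
qed

theorem extreme_iff_ergodic:
  assumes M: "M \<in> M_qi1 V r"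
  shows "extreme_measure M (M_qi1 V r) \<longleftrightarrow>
    ergodic_for (density M (\<lambda>x. ennreal (V (coord 0 x)))) (rhat r)"
proof
  assume erg: "ergodic_for (density M (\<lambda>x. ennreal (V (coord 0 x)))) (rhat r)"
  interpret prob_space M by (rule qi_prob[OF M])
  show "extreme_measure M (M_qi1 V r)"
  proof (rule extreme_measureI[OF M])
    fix L L' and t :: real
    assume L: "L \<in> M_qi1 V r" and t: "0 < t" and
      eq: "\<And>A. A \<in> sets M \<Longrightarrow> emeasure M A = ennreal t * emeasure L A + ennreal (1 - t) * emeasure L' A"
    have "sets L = sets M" by (simp add: qi_sets L M)
    then obtain F where F: "F \<in> borel_measurable M" "\<And>x. 0 \<le> F x" "L = density M (\<lambda>x. ennreal (F x))"
      using dominated_density[OF finite_measure_axioms _ _ dominated_summand[OF t eq]] t by auto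
    then show "L = M" using ergodic_density_const[OF erg M _ F(1,2)] L by simp
  qed
qed (rule extreme_imp_ergodic)

section \<open>Extremality and relative ergodicity\<close>

lemma fix_integrable:
  fixes f :: "'a \<Rightarrow> real"
  assumes N: "N \<in> M_fix1 V r" and f[measurable]: "f \<in> borel_measurable borel" and "bounded (range f)"
  shows "integrable N (\<lambda>x. V x * f x)" "integrable N f"
proof -
  note [measurable_cong] = fix_sets[OF N]
  interpret prob_space N by (rule fix_prob[OF N])
  obtain C where C: "\<And>x. \<bar>f x\<bar> \<le> C"
    using assms(3) by (auto simp: bounded_iff)
  show "integrable N f" by (rule integrable_const_bound[of _ C]) (auto simp: C)
  have "(\<integral>\<^sup>+x. ennreal (V x) \<partial>N) = 1"
    using nn_integral_fix[OF N, of "\<lambda>_. 1"] emeasure_space_1 by simp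
  then have V: "integrable N V" by (intro integrableI_nonneg) (auto simp: V_nonneg)
  show "integrable N (\<lambda>x. V x * f x)"
  proof (rule Bochner_Integration.integrable_bound)
    show "integrable N (\<lambda>x. V x * C)" using V by simp
    show "AE x in N. norm (V x * f x) \<le> norm (V x * C)"
      using C V_nonneg by (auto simp: abs_mult intro!: mult_left_mono order_trans[OF C])
  qed measurable
qed

lemma integral_fix:
  fixes h :: "'a \<Rightarrow> real"
  assumes N: "N \<in> M_fix1 V r" and h[measurable]: "h \<in> borel_measurable borel"
  shows "(\<integral>x. V x * h (r x) \<partial>N) = (\<integral>x. h x \<partial>N)"
proof -
  note [measurable_cong] = fix_sets[OF N]
  have "(\<integral>x. h x \<partial>N) = (\<integral>x. h x \<partial>distr (density N (\<lambda>x. ennreal (V x))) borel r)"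
    by (simp add: fix_distr[OF N])
  also have "\<dots> = (\<integral>x. V x * h (r x) \<partial>N)"
    by (simp add: integral_distr integral_density V_nonneg)
  finally show ?thesis by simp
qed

text \<open>
  The fixed point equation for \<open>f dN\<close>, as a condition linear in \<open>f\<close> that makes sense for \<open>f\<close> of
  any sign.
\<close>

definition transfer_fixed :: "'a measure \<Rightarrow> ('a \<Rightarrow> real) \<Rightarrow> bool" where
  "transfer_fixed N f \<longleftrightarrow>
     (\<forall>B\<in>sets borel. (\<integral>x. V x * f x * indicator B (r x) \<partial>N) = (\<integral>x. f x * indicator B x \<partial>N))"

lemma bounded_mult_indicator:
  fixes f :: "'a \<Rightarrow> real"
  assumes "bounded (range f)"
  shows "bounded (range (\<lambda>x. f x * indicator (B x) (g x)))"
proof -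
  obtain C where C: "\<And>x. \<bar>f x\<bar> \<le> C" using assms by (auto simp: bounded_iff)
  then have "0 \<le> C" by (meson abs_ge_zero order_trans)
  with C show ?thesis by (auto simp: bounded_iff indicator_def intro!: exI[of _ C])
qed

lemma transfer_fixed_affine:
  assumes N: "N \<in> M_fix1 V r" and f[measurable]: "f \<in> borel_measurable borel" and bd: "bounded (range f)"
    and fixed: "transfer_fixed N f"
  shows "transfer_fixed N (\<lambda>x. a + b * f x)"
  unfolding transfer_fixed_def
proof
  note [measurable_cong] = fix_sets[OF N]
  fix B :: "'a set" assume B[measurable]: "B \<in> sets borel"
  have bc: "bounded (range (\<lambda>_::'a. 1::real))" by simp
  note bi = bounded_mult_indicator
  have i1: "integrable N (\<lambda>x. V x * f x * indicator B (r x))" "integrable N (\<lambda>x. f x * indicator B x)"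
    using fix_integrable(1)[OF N _ bi[OF bd, of "\<lambda>_. B" r]]
      fix_integrable(2)[OF N _ bi[OF bd, of "\<lambda>_. B" "\<lambda>x. x"]]
    by (simp_all add: mult.assoc)
  have i2: "integrable N (\<lambda>x. V x * indicator B (r x))" "integrable N (\<lambda>x. indicator B x :: real)"
    using fix_integrable(1)[OF N _ bi[OF bc, of "\<lambda>_. B" r]]
      fix_integrable(2)[OF N _ bi[OF bc, of "\<lambda>_. B" "\<lambda>x. x"]]
    by simp_all
  have "(\<integral>x. V x * (a + b * f x) * indicator B (r x) \<partial>N)
      = (\<integral>x. a * (V x * indicator B (r x)) + b * (V x * f x * indicator B (r x)) \<partial>N)"
    by (rule Bochner_Integration.integral_cong) (auto simp: algebra_simps)
  also have "\<dots> = a * (\<integral>x. V x * indicator B (r x) \<partial>N) + b * (\<integral>x. V x * f x * indicator B (r x) \<partial>N)"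
    using i1 i2 by simp
  also have "\<dots> = a * (\<integral>x. indicator B x \<partial>N) + b * (\<integral>x. f x * indicator B x \<partial>N)"
    using fixed B integral_fix[OF N, of "indicator B"] by (simp add: transfer_fixed_def)
  also have "\<dots> = (\<integral>x. a * indicator B x + b * (f x * indicator B x) \<partial>N)"
    using i1 i2 by simp
  also have "\<dots> = (\<integral>x. (a + b * f x) * indicator B x \<partial>N)"
    by (rule Bochner_Integration.integral_cong) (auto simp: algebra_simps)
  finally show "(\<integral>x. V x * (a + b * f x) * indicator B (r x) \<partial>N) = \<dots>" .
qed

lemma fix_density_iff:
  assumes N: "N \<in> M_fix1 V r" and f[measurable]: "f \<in> borel_measurable borel" and bd: "bounded (range f)"
    and f0: "\<And>x. 0 \<le> f x"
  shows "density N (\<lambda>x. ennreal (f x)) \<in> M_fix1 V r \<longleftrightarrow>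
    (\<integral>\<^sup>+x. ennreal (f x) \<partial>N) = 1 \<and> transfer_fixed N f"
proof -
  note [measurable_cong] = fix_sets[OF N]
  let ?D = "density N (\<lambda>x. ennreal (f x))"
  let ?T = "distr (density ?D (\<lambda>x. ennreal (V x))) borel r"
  have *: "emeasure ?T B = ennreal (\<integral>x. V x * f x * indicator B (r x) \<partial>N)
        \<and> emeasure ?D B = ennreal (\<integral>x. f x * indicator B x \<partial>N)"
    if B[measurable]: "B \<in> sets borel" for B
  proof
    have "emeasure ?T B = (\<integral>\<^sup>+y. indicator B y \<partial>?T)" by simp
    also have "\<dots> = (\<integral>\<^sup>+x. ennreal (f x) * (ennreal (V x) * indicator B (r x)) \<partial>N)"
      by (simp add: nn_integral_distr nn_integral_density del: nn_integral_indicator)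
    also have "\<dots> = (\<integral>\<^sup>+x. ennreal (V x * f x * indicator B (r x)) \<partial>N)"
      by (rule nn_integral_cong) (auto simp: indicator_def ennreal_mult f0 V_nonneg mult.commute)
    also have "\<dots> = ennreal (\<integral>x. V x * f x * indicator B (r x) \<partial>N)"
      using fix_integrable(1)[OF N _ bounded_mult_indicator[OF bd, of "\<lambda>_. B" r]]
      by (intro nn_integral_eq_integral) (auto simp: mult.assoc f0 V_nonneg)
    finally show "emeasure ?T B = \<dots>" .
    have "emeasure ?D B = (\<integral>\<^sup>+x. ennreal (f x * indicator B x) \<partial>N)"
      by (auto simp: emeasure_density indicator_def intro!: nn_integral_cong)
    also have "\<dots> = ennreal (\<integral>x. f x * indicator B x \<partial>N)"
      using fix_integrable(2)[OF N _ bounded_mult_indicator[OF bd, of "\<lambda>_. B" "\<lambda>x. x"]]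
      by (intro nn_integral_eq_integral) (auto simp: f0)
    finally show "emeasure ?D B = \<dots>" .
  qed
  have "?T = ?D \<longleftrightarrow> (\<forall>B\<in>sets borel. emeasure ?T B = emeasure ?D B)"
    by (auto intro!: measure_eqI simp: fix_sets[OF N])
  also have "\<dots> \<longleftrightarrow> transfer_fixed N f"
    unfolding transfer_fixed_def using *
    by (auto simp: ennreal_inj f0 V_nonneg intro!: ball_cong Bochner_Integration.integral_nonneg)
  finally have "?T = ?D \<longleftrightarrow> transfer_fixed N f" .
  moreover have "emeasure ?D UNIV = (\<integral>\<^sup>+x. ennreal (f x) \<partial>N)"
    by (simp add: emeasure_density)
  ultimately show ?thesis
    by (simp add: M_fix1_iff fix_sets[OF N])
qed

text \<open>
  Against \<open>1\<^sub>B \<circ> r\<close>, which is measurable for the pulled-back \<open>\<sigma>\<close>-algebra, the left-hand side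
  integrates to \<open>\<integral>V f (1\<^sub>B \<circ> r) dN\<close>; the right-hand side integrates to \<open>\<integral>V (f \<circ> r) (1\<^sub>B \<circ> r) dN\<close>,
  which is \<open>\<integral>f 1\<^sub>B dN\<close> since \<open>N\<close> is fixed.
\<close>

lemma relative_equation_iff:
  assumes N: "N \<in> M_fix1 V r" and f[measurable]: "f \<in> borel_measurable borel" and bd: "bounded (range f)"
  shows "(AE x in restr_to_subalg N (pullback_alg r).
           real_cond_exp N (pullback_alg r) (\<lambda>y. V y * f y) x
             = real_cond_exp N (pullback_alg r) V x * f (r x)) \<longleftrightarrow> transfer_fixed N f"
proof -
  note [measurable_cong] = fix_sets[OF N]
  interpret P: prob_space N by (rule fix_prob[OF N])
  define G where "G = pullback_alg r"
  have setsG: "sets G = {r -` B | B. B \<in> sets borel}"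
    by (auto simp: G_def pullback_alg_def sets_vimage_algebra2)
  have sub: "subalgebra N G"
    unfolding subalgebra_def setsG fix_sets[OF N]
    using measurable_sets[OF r_meas] by (auto simp: fix_space[OF N] G_def pullback_alg_def)
  interpret finite_measure_subalgebra N G
    by unfold_locales (rule sub)
  have rG[measurable]: "r \<in> G \<rightarrow>\<^sub>M borel"
    unfolding G_def pullback_alg_def by (rule measurable_vimage_algebra1) simp
  let ?E = "real_cond_exp N G"
  have bdr: "bounded (range (\<lambda>x. f (r x)))"
    using bd by (rule bounded_subset) auto
  have intVf: "integrable N (\<lambda>x. V x * f x)" by (rule fix_integrable(1)[OF N f bd])
  have int1: "integrable N (\<lambda>x. f (r x) * V x)"
    using fix_integrable(1)[OF N _ bdr] by (simp add: mult.commute)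
  have intB: "integrable N (\<lambda>x. indicator B (r x) * (V x * f x))"
    "integrable N (\<lambda>x. (indicator B (r x) * f (r x)) * V x)"
    if [measurable]: "B \<in> sets borel" for B
    using fix_integrable(1)[OF N _ bounded_mult_indicator[OF bd, of "\<lambda>_. B" r]]
      fix_integrable(1)[OF N _ bounded_mult_indicator[OF bdr, of "\<lambda>_. B" r]]
    by (simp_all add: ac_simps)
  have right: "(\<integral>x. indicator B (r x) * (?E V x * f (r x)) \<partial>N) = (\<integral>x. f x * indicator B x \<partial>N)"
    if B[measurable]: "B \<in> sets borel" for B
  proof -
    have "(\<integral>x. indicator B (r x) * (?E V x * f (r x)) \<partial>N)
        = (\<integral>x. (indicator B (r x) * f (r x)) * ?E V x \<partial>N)"
      by (simp add: ac_simps)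
    also have "\<dots> = (\<integral>x. (indicator B (r x) * f (r x)) * V x \<partial>N)"
      by (rule real_cond_exp_intg(2)[OF intB(2)[OF B]]) measurable
    also have "\<dots> = (\<integral>x. f x * indicator B x \<partial>N)"
      using integral_fix[OF N, of "\<lambda>x. f x * indicator B x"] by (simp add: ac_simps)
    finally show ?thesis .
  qed
  show ?thesis
    unfolding G_def[symmetric]
  proof
    assume "AE x in restr_to_subalg N G. ?E (\<lambda>y. V y * f y) x = ?E V x * f (r x)"
    then have AE: "AE x in N. ?E (\<lambda>y. V y * f y) x = ?E V x * f (r x)"
      by (rule AE_restr_to_subalg[OF sub])
    show "transfer_fixed N f"
      unfolding transfer_fixed_def
    proof
      fix B :: "'a set" assume B[measurable]: "B \<in> sets borel"
      have "(\<integral>x. V x * f x * indicator B (r x) \<partial>N) = (\<integral>x. indicator B (r x) * (V x * f x) \<partial>N)"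
        by (simp add: ac_simps)
      also have "\<dots> = (\<integral>x. indicator B (r x) * ?E (\<lambda>y. V y * f y) x \<partial>N)"
        by (rule real_cond_exp_intg(2)[OF intB(1)[OF B], symmetric]) measurable
      also have "\<dots> = (\<integral>x. indicator B (r x) * (?E V x * f (r x)) \<partial>N)"
        by (rule integral_cong_AE) (use AE in \<open>auto elim!: eventually_mono\<close>)
      also have "\<dots> = (\<integral>x. f x * indicator B x \<partial>N)" by (rule right[OF B])
      finally show "(\<integral>x. V x * f x * indicator B (r x) \<partial>N) = \<dots>" .
    qed
  next
    assume fixed: "transfer_fixed N f"
    have "AE x in N. ?E (\<lambda>y. V y * f y) x = ?E V x * f (r x)"
    proof (rule real_cond_exp_charact[OF _ intVf])
      show "integrable N (\<lambda>x. ?E V x * f (r x))"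
        using real_cond_exp_intg(1)[OF int1] by (simp add: mult.commute)
      fix A assume "A \<in> sets G"
      then obtain B where B: "B \<in> sets borel" "A = r -` B" by (auto simp: setsG)
      have ind: "indicator A x = (indicator B (r x) :: real)" for x
        by (simp add: B(2) indicator_def)
      have "(\<integral>x\<in>A. V x * f x \<partial>N) = (\<integral>x. V x * f x * indicator B (r x) \<partial>N)"
        by (simp add: set_lebesgue_integral_def ind mult.commute)
      also have "\<dots> = (\<integral>x. indicator B (r x) * (?E V x * f (r x)) \<partial>N)"
        using fixed B(1) by (simp add: transfer_fixed_def right)
      also have "\<dots> = (\<integral>x\<in>A. ?E V x * f (r x) \<partial>N)"
        by (simp add: set_lebesgue_integral_def ind)
      finally show "(\<integral>x\<in>A. V x * f x \<partial>N) = \<dots>" .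
    qed measurable
    then show "AE x in restr_to_subalg N G. ?E (\<lambda>y. V y * f y) x = ?E V x * f (r x)"
      by (rule AE_restr_to_subalg2[OF sub]) measurable
  qed
qed

text \<open>
  A bounded solution \<open>f\<close> of the relative equation splits \<open>N\<close> into affine images of \<open>f\<close>, which are
  again solutions; conversely the density of a component of \<open>N\<close> is a bounded solution.
\<close>

theorem extreme_iff_relatively_ergodic:
  assumes N: "N \<in> M_fix1 V r"
  shows "extreme_measure N (M_fix1 V r) \<longleftrightarrow> relatively_ergodic r V N"
proof
  note [measurable_cong] = fix_sets[OF N]
  interpret prob_space N by (rule fix_prob[OF N])
  show "relatively_ergodic r V N" if ext: "extreme_measure N (M_fix1 V r)"
    unfolding relatively_ergodic_def
  proof (intro ballI impI, elim conjE)
    fix f :: "'a \<Rightarrow> real"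
    assume f[measurable]: "f \<in> borel_measurable borel" and f0: "\<forall>x. 0 \<le> f x" and bd: "bounded (range f)"
      and "AE x in restr_to_subalg N (pullback_alg r).
           real_cond_exp N (pullback_alg r) (\<lambda>y. V y * f y) x
             = real_cond_exp N (pullback_alg r) V x * f (r x)"
    then have fixed: "transfer_fixed N f" by (simp add: relative_equation_iff[OF N])
    obtain C where C: "\<And>x. \<bar>f x\<bar> \<le> C" using bd by (auto simp: bounded_iff)
    show "\<exists>c. AE x in N. f x = c"
    proof (rule extreme_measure_bounded_const[OF ext fix_prob[OF N], where C = C])
      show "f x \<le> C" for x using C[of x] by simp
      fix a b :: real
      assume nonneg: "\<And>x. 0 \<le> a + b * f x" and int1: "(\<integral>\<^sup>+x. ennreal (a + b * f x) \<partial>N) = 1"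
      have "bounded (range (\<lambda>x. a + b * f x))"
        unfolding bounded_iff
      proof (intro exI ballI)
        show "norm y \<le> \<bar>a\<bar> + \<bar>b\<bar> * C" if "y \<in> range (\<lambda>x. a + b * f x)" for y
          using that C by (auto simp: abs_mult intro!: order_trans[OF abs_triangle_ineq] mult_left_mono)
      qed
      then show "density N (\<lambda>x. ennreal (a + b * f x)) \<in> M_fix1 V r"
        using transfer_fixed_affine[OF N f bd fixed] int1 nonneg
        by (subst fix_density_iff[OF N]) auto
    qed (use f0 in auto)
  qed
  show "extreme_measure N (M_fix1 V r)" if rel: "relatively_ergodic r V N"
  proof (rule extreme_measureI[OF N])
    fix L L' and t :: real
    assume L: "L \<in> M_fix1 V r" and t: "0 < t" and
      eq: "\<And>A. A \<in> sets N \<Longrightarrow> emeasure N A = ennreal t * emeasure L A + ennreal (1 - t) * emeasure L' A"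
    have "sets L = sets N" by (simp add: fix_sets L N)
    then obtain f where "f \<in> borel_measurable N" and f0: "\<And>x. 0 \<le> f x" and f_le: "\<And>x. f x \<le> 1 / t"
      and L_eq: "L = density N (\<lambda>x. ennreal (f x))"
      using dominated_density[OF finite_measure_axioms _ _ dominated_summand[OF t eq]] t
      by (metis less_eq_real_def zero_le_divide_1_iff)
    then have f[measurable]: "f \<in> borel_measurable borel" by measurable
    have bd: "bounded (range f)"
      using f0 f_le by (auto simp: bounded_iff)
    have int1: "(\<integral>\<^sup>+x. ennreal (f x) \<partial>N) = 1" and "transfer_fixed N f"
      using L unfolding L_eq by (simp_all add: fix_density_iff[OF N f bd f0])
    then have "AE x in restr_to_subalg N (pullback_alg r).
           real_cond_exp N (pullback_alg r) (\<lambda>y. V y * f y) x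
             = real_cond_exp N (pullback_alg r) V x * f (r x)"
      by (simp only: relative_equation_iff[OF N f bd])
    then obtain c where c: "AE x in N. f x = c"
      using rel[unfolded relatively_ergodic_def, rule_format, OF f] f0 bd by blast
    then have "(\<integral>\<^sup>+x. ennreal (f x) \<partial>N) = (\<integral>\<^sup>+x. ennreal c \<partial>N)"
      by (intro nn_integral_cong_AE) (auto elim: eventually_mono)
    then have "ennreal c = 1" using int1 emeasure_space_1 by simp
    then have "L = density N (\<lambda>x. 1)"
      unfolding L_eq using c by (intro density_cong) (auto elim!: eventually_mono)
    then show "L = N" by (simp add: density_1)
  qed
qed

end

theorem theorem7p3:
  fixes r :: "'a::t2_space \<Rightarrow> 'a"
    and V :: "'a \<Rightarrow> real"
    and muhat :: "(nat \<Rightarrow> 'a) measure"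
    and mu0 :: "'a measure"
  assumes compact_X: "compact (UNIV :: 'a set)"
    and r_meas: "r \<in> borel \<rightarrow>\<^sub>M borel"
    and r_fibres: "\<forall>x. finite (r -` {x}) \<and> 1 \<le> card (r -` {x})"
    and r_not_invertible: "\<exists>x. card (r -` {x}) \<noteq> 1"
    and V_meas: "V \<in> borel_measurable borel"
    and V_nonneg: "\<forall>x. 0 \<le> V x"
    and V_bounded: "bounded (range V)"
    and muhat: "muhat \<in> M_qi1 V r"
    and mu0: "mu0 = distr muhat borel (coord 0)"
  shows "mu0 \<in> M_fix1 V r \<and>
    (extreme_measure muhat (M_qi1 V r)
       \<longleftrightarrow> ergodic_for (density muhat (\<lambda>x. ennreal (V (coord 0 x)))) (rhat r)) \<and>
    (ergodic_for (density muhat (\<lambda>x. ennreal (V (coord 0 x)))) (rhat r)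
       \<longleftrightarrow> extreme_measure mu0 (M_fix1 V r)) \<and>
    (extreme_measure mu0 (M_fix1 V r) \<longleftrightarrow> relatively_ergodic r V mu0)"
proof -
  have "surj r"
    unfolding surj_def
  proof
    fix y
    have "card (r -` {y}) \<noteq> 0" using r_fibres by (metis not_one_le_zero)
    then have "r -` {y} \<noteq> {}" by (metis card.empty)
    then show "\<exists>x. y = r x" by auto
  qed
  then interpret weighted_map r V
    using r_meas V_meas V_nonneg by unfold_locales auto
  show ?thesis
    unfolding mu0
    using marginal_fix[OF muhat] extreme_iff_ergodic[OF muhat] extreme_qi_iff_extreme_fix[OF muhat]
      extreme_iff_relatively_ergodic[OF marginal_fix[OF muhat]]
    by blast
qed

end
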